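(* Let $\ell,n\ge 1$ be integers and let $\mu,\nu\vDash_\ell n$ be $\ell$-multicompositions of $n$. Applying the classical RSK correspondence componentwise, i.e. the map $\Psi_\ell$ defined in the context, gives a (well-defined) bijection $$\Psi_\ell:\ \mathrm{ParMat}^{\flat}_{\nu,\mu}\ \longrightarrow\ \coprod_{\lambda\vdash_\ell n}\mathrm{SST}_\ell(\lambda,\mu)\times \mathrm{SST}_\ell(\lambda,\nu).$$ Moreover: (i) Let $\ell\ge 2$. When restricted to $\mu^{(\ell)}=\nu^{(\ell)}=\lambda^{(\ell)}=\varnothing$ (where $\lambda$ is the shape of the image), $\Psi_\ell$ agrees with the level-$(\ell-1)$ correspondence $\Psi_{\ell-1}$ attached to $(\nu^{(1)},\dots,\nu^{(\ell-1)})$ and $(\mu^{(1)},\dots,\mu^{(\ell-1)})$, under the identifications that delete the blocks $(p,q)$ with $p=\ell$ or $q=\ell$ from $(A,P)$ (these blocks of $A$ are zero and these blocks of $P$ consist of empty partitions) and delete the empty $\ell$-th components of $\lambda$ and of the multitableaux. (ii) If $\ell=1$, then, identifying $(A,P)$ with the single matrix $A^{(11)}$ (all entries of $P$ being empty partitions) and the letter $a_1$ with $a$, $\Psi_1$ is the usual RSK correspondence between matrices of nonnegative integers with row sums $\nu^{(1)}$ and column sums $\mu^{(1)}$ and pairs of semistandard tableaux of the same shape $\lambda\vdash n$ and contents $\mu^{(1)}$ and $\nu^{(1)}$ respectively.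
   Context: Compositions. A composition is a finite vector $\alpha=(\alpha_1,\dots,\alpha_k)$ of nonnegative integers, with $|\alpha|=\sum_i\alpha_i$; parts beyond the last are read as $0$. A partition is a composition (possibly empty) with $\alpha_i\ge\alpha_{i+1}>0$; its length is its number of parts. An $\ell$-multicomposition (resp. $\ell$-multipartition) of $n$, written $\mu\vDash_\ell n$ (resp. $\lambda\vdash_\ell n$), is an $\ell$-tuple $(\mu^{(1)},\dots,\mu^{(\ell)})$ of compositions (resp. partitions) with $\sum_i|\mu^{(i)}|=n$. Letters. $\mathcal S=\{a_b: a,b\in\{1,2,\dots\}\}$ is totally ordered by $1_1<2_1<3_1<\cdots<1_2<2_2<\cdots<1_3<\cdots$ (compare subscripts first, then $a$). For $\mu\vDash_\ell n$, the $\mu$-alphabet $U_\mu$ is the finite multiset of letters of $\mathcal S$ in which $a_b$ ($1\le b\le\ell$) has multiplicity $\mu^{(b)}_a$, and no other letters occur. Multitableaux. A semistandard tableau has weakly increasing rows and strictly increasing columns. For $\lambda\vdash_\ell n$ and $\mu\vDash_\ell n$, $\mathrm{SST}_\ell(\lambda,\mu)$ is the set of $\ell$-tuples $T=(T^{(1)},\dots,T^{(\ell)})$ where $T^{(i)}$ is a semistandard tableau of shape $\lambda^{(i)}$ with entries in $\mathcal S$, the multiset of all entries of $T^{(1)},\dots,T^{(\ell)}$ together is $U_\mu$, and a letter $a_b$ occurs in $T^{(i)}$ only if $b\ge i$. The set $\mathrm{ParMat}^\flat_{\nu,\mu}$. It consists of all pairs $(A,P)$ where: $A=\{A^{(pq)}\}_{1\le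 p,q\le\ell}$ is a collection of matrices $A^{(pq)}=(a^{(pq)}_{ij})_{i,j\ge1}$ of nonnegative integers with finitely many nonzero entries; $\sum_{q=1}^{\ell}\sum_j a^{(sq)}_{tj}=\nu^{(s)}_t$ and $\sum_{p=1}^{\ell}\sum_i a^{(ps)}_{it}=\mu^{(s)}_t$ for all $1\le s\le\ell$, $t\ge1$; $P=\{P^{(pq)}\}_{1\le p,q\le\ell}$ is a collection of matrices $P^{(pq)}=(\eta^{(pq)}_{ij})_{i,j\ge1}$ of partitions, all but finitely many empty; and for all $p,q,i,j$ the largest part of $\eta^{(pq)}_{ij}$ is at most $a^{(pq)}_{ij}$ and $\mathrm{length}(\eta^{(pq)}_{ij})\le\min(p,q)-1$. Biwords and RSK. A biword over a totally ordered set is a finite array $\begin{pmatrix}\alpha_1&\cdots&\alpha_k\\ \beta_1&\cdots&\beta_k\end{pmatrix}$ with $\alpha_1\le\cdots\le\alpha_k$ and $\beta_i\le\beta_{i+1}$ whenever $\alpha_i=\alpha_{i+1}$; it is determined by the multiplicities of its columns (biletters). Its RSK image $(\mathbf P,\mathbf Q)$ is obtained by row-inserting $\beta_1,\dots,\beta_k$ successively, starting from the empty tableau (an inserted $x$ replaces the leftmost entry strictly greater than $x$ in the row, which is then inserted in the next row; if there is no such entry, $x$ is appended at the end of the row), to get $\mathbf P$, and placing $\alpha_i$ in the box created at step $i$ to get $\mathbf Q$. The usual RSK correspondence for a matrix $(a_{ij})$ of nonnegative integers with finitely many nonzero entries is RSK applied to the biword in which $\begin{pmatrix} i \\ j \end{pmatrix}$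 has multiplicity $a_{ij}$. The map $\Psi_\ell$. Given $(A,P)\in\mathrm{ParMat}^\flat_{\nu,\mu}$, set $(\eta^{(pq)}_{ij})_0:=a^{(pq)}_{ij}$ and $(\eta^{(pq)}_{ij})_k:=0$ for $k>\mathrm{length}(\eta^{(pq)}_{ij})$. For $1\le t\le\ell$ let $w^{(t)}$ be the biword over $\mathcal S$ in which the biletter $\begin{pmatrix} i_p \\ j_q \end{pmatrix}$ has multiplicity $(\eta^{(pq)}_{ij})_{t-1}-(\eta^{(pq)}_{ij})_t$ for all $1\le p,q\le\ell$ and $i,j\ge1$, with no other biletters. Let $(\mathbf P^{(t)},\mathbf Q^{(t)})$ be the RSK image of $w^{(t)}$ and put $\Psi_\ell(A,P)=\big((\mathbf P^{(1)},\dots,\mathbf P^{(\ell)}),(\mathbf Q^{(1)},\dots,\mathbf Q^{(\ell)})\big)$. *)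

theory Defs
  imports
    "HOL-Library.Multiset"
    "HOL-Library.More_List"
    "HOL-Library.FuncSet"
    "HOL-Library.Groups_Big_Fun"
    "HOL-Library.Product_Lexorder"
begin

text \<open>
  All mathematical indices (parts, tuple components, blocks, matrix rows and columns, letters)
  start at 1.  Tuples are lists, so component \<open>i\<close> sits at list position \<open>i - 1\<close>.
\<close>

section \<open>Compositions and partitions\<close>

abbreviation component :: "'a list \<Rightarrow> nat \<Rightarrow> 'a" where
  "component xs i \<equiv> xs ! (i - 1)"

text \<open>Parts beyond the last are 0.  Only meaningful for \<open>i \<ge> 1\<close>.\<close>

definition part :: "nat list \<Rightarrow> nat \<Rightarrow> nat" where
  "part \<alpha> i = nth_default 0 \<alpha> (i - 1)"

definition is_partition :: "nat list \<Rightarrow> bool" where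
  "is_partition \<alpha> \<longleftrightarrow> sorted_wrt (\<ge>) \<alpha> \<and> (\<forall>x\<in>set \<alpha>. 0 < x)"

definition multicompositions :: "nat \<Rightarrow> nat \<Rightarrow> nat list list set" where
  "multicompositions l n = {\<mu>. length \<mu> = l \<and> (\<Sum>i=1..l. sum_list (component \<mu> i)) = n}"

definition multipartitions :: "nat \<Rightarrow> nat \<Rightarrow> nat list list set" where
  "multipartitions l n = {\<Lambda> \<in> multicompositions l n. \<forall>i\<in>{1..l}. is_partition (component \<Lambda> i)}"

section \<open>Letters\<close>

text \<open>
  The letter \<open>a\<^sub>b\<close> is the pair \<open>(b, a)\<close>, subscript first, so that the lexicographic order on pairs
  compares subscripts first.
\<close>

type_synonym letter = "nat \<times> nat"

abbreviation (input) letter :: "nat \<Rightarrow> nat \<Rightarrow> letter" where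
  "letter a b \<equiv> (b, a)"

definition letters :: "letter set" where
  "letters = {letter a b | a b. 1 \<le> a \<and> 1 \<le> b}"

definition alphabet :: "nat list list \<Rightarrow> letter multiset" where
  "alphabet \<mu> = Abs_multiset (\<lambda>(b, a).
     if 1 \<le> a \<and> 1 \<le> b \<and> b \<le> length \<mu> then part (component \<mu> b) a else 0)"

lemma finite_parts: "finite {a. 1 \<le> a \<and> 0 < part \<alpha> a}"
proof (rule finite_subset)
  show "{a. 1 \<le> a \<and> 0 < part \<alpha> a} \<subseteq> {..length \<alpha>}"
  proof
    fix a assume "a \<in> {a. 1 \<le> a \<and> 0 < part \<alpha> a}"
    then have "a - 1 < length \<alpha>"
      by (auto simp: part_def nth_default_def split: if_splits)
    then show "a \<in> {..length \<alpha>}" by simp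
  qed
qed simp

lemma count_alphabet:
  "count (alphabet \<mu>) (letter a b) =
     (if 1 \<le> a \<and> 1 \<le> b \<and> b \<le> length \<mu> then part (component \<mu> b) a else 0)"
proof -
  let ?f = "\<lambda>(b, a). if 1 \<le> a \<and> 1 \<le> b \<and> b \<le> length \<mu> then part (component \<mu> b) a else 0"
  have "{x. 0 < ?f x} \<subseteq> (SIGMA b:{..length \<mu>}. {a. 1 \<le> a \<and> 0 < part (component \<mu> b) a})"
    by (auto split: if_splits)
  then have "finite {x. 0 < ?f x}"
    by (rule finite_subset) (intro finite_SigmaI finite_atMost finite_parts)
  then show ?thesis
    unfolding alphabet_def by (subst Abs_multiset_inverse) auto
qed

section \<open>Tableaux\<close>

text \<open>
  A tableau is the list of its rows from top to bottom.  Since the shape of a semistandard tableau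
  is a partition, it has no empty rows; the empty tableau is \<open>[]\<close>.
\<close>

type_synonym 'a tableau = "'a list list"

definition shape :: "'a tableau \<Rightarrow> nat list" where
  "shape T = map length T"

definition entries :: "'a tableau \<Rightarrow> 'a multiset" where
  "entries T = mset (concat T)"

definition semistandard :: "'a::linorder tableau \<Rightarrow> bool" where
  "semistandard T \<longleftrightarrow> is_partition (shape T) \<and> (\<forall>r\<in>set T. sorted r) \<and>
     (\<forall>i j. Suc i < length T \<and> j < length (T ! Suc i) \<longrightarrow> T ! i ! j < T ! Suc i ! j)"

definition SST :: "nat \<Rightarrow> nat list list \<Rightarrow> nat list list \<Rightarrow> letter tableau list set" where
  "SST l \<Lambda> \<mu> = {T. length T = l \<and>
     (\<forall>i\<in>{1..l}. semistandard (component T i) \<and> shape (component T i) = component \<Lambda> i \<and>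
        set_mset (entries (component T i)) \<subseteq> letters) \<and>
     (\<Sum>i=1..l. entries (component T i)) = alphabet \<mu> \<and>
     (\<forall>i\<in>{1..l}. \<forall>a b. letter a b \<in># entries (component T i) \<longrightarrow> i \<le> b)}"

definition SST_content :: "nat list \<Rightarrow> nat list \<Rightarrow> nat tableau set" where
  "SST_content \<Lambda> \<alpha> = {T. semistandard T \<and> shape T = \<Lambda> \<and>
     (\<forall>a. count (entries T) a = (if 1 \<le> a then part \<alpha> a else 0))}"

section \<open>Matrices and the set ParMat\<close>

text \<open>
  Matrices indexed by \<open>i, j \<ge> 1\<close> are functions on all of \<^typ>\<open>nat\<close> whose unused row and column 0
  are trivial.
\<close>

definition nat_matrices :: "(nat \<Rightarrow> nat \<Rightarrow> nat) set" where
  "nat_matrices = {M. finite {(i, j). M i j \<noteq> 0} \<and> (\<forall>i. M i 0 = 0 \<and> M 0 i = 0)}"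

definition partition_matrices :: "(nat \<Rightarrow> nat \<Rightarrow> nat list) set" where
  "partition_matrices = {M. (\<forall>i j. is_partition (M i j)) \<and> finite {(i, j). M i j \<noteq> []} \<and>
     (\<forall>i. M i 0 = [] \<and> M 0 i = [])}"

type_synonym parmat =
  "(nat \<times> nat \<Rightarrow> nat \<Rightarrow> nat \<Rightarrow> nat) \<times> (nat \<times> nat \<Rightarrow> nat \<Rightarrow> nat \<Rightarrow> nat list)"

abbreviation blocks :: "nat \<Rightarrow> (nat \<times> nat) set" where
  "blocks l \<equiv> {1..l} \<times> {1..l}"

definition ParMat :: "nat \<Rightarrow> nat list list \<Rightarrow> nat list list \<Rightarrow> parmat set" where
  "ParMat l \<nu> \<mu> = {(A, P).
     A \<in> blocks l \<rightarrow>\<^sub>E nat_matrices \<and>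
     P \<in> blocks l \<rightarrow>\<^sub>E partition_matrices \<and>
     (\<forall>s\<in>{1..l}. \<forall>t\<ge>1. (\<Sum>q=1..l. \<Sum>j. A (s, q) t j) = part (component \<nu> s) t) \<and>
     (\<forall>s\<in>{1..l}. \<forall>t\<ge>1. (\<Sum>p=1..l. \<Sum>i. A (p, s) i t) = part (component \<mu> s) t) \<and>
     (\<forall>p\<in>{1..l}. \<forall>q\<in>{1..l}. \<forall>i\<ge>1. \<forall>j\<ge>1.
        (\<forall>x\<in>set (P (p, q) i j). x \<le> A (p, q) i j) \<and>
        length (P (p, q) i j) \<le> min p q - 1)}"

definition delete_last_blocks :: "nat \<Rightarrow> parmat \<Rightarrow> parmat" where
  "delete_last_blocks l = (\<lambda>(A, P). (restrict A (blocks (l - 1)), restrict P (blocks (l - 1))))"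

section \<open>Biwords and RSK\<close>

text \<open>A biword is the list of its columns \<open>(\<alpha>\<^sub>i, \<beta>\<^sub>i)\<close>.\<close>

definition biword :: "('a::linorder \<times> 'b::linorder) list \<Rightarrow> bool" where
  "biword w \<longleftrightarrow> (\<forall>i. Suc i < length w \<longrightarrow> fst (w ! i) \<le> fst (w ! Suc i) \<and>
     (fst (w ! i) = fst (w ! Suc i) \<longrightarrow> snd (w ! i) \<le> snd (w ! Suc i)))"

text \<open>The biword with prescribed (finitely supported) multiplicities of its columns.\<close>

definition biword_of :: "('a::linorder \<times> 'b::linorder \<Rightarrow> nat) \<Rightarrow> ('a \<times> 'b) list" where
  "biword_of m = sorted_list_of_multiset (Abs_multiset m)"

lemma biword_iff_sorted: "biword w \<longleftrightarrow> sorted w"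
  unfolding biword_def sorted_iff_nth_Suc
  by (auto simp: less_eq_prod_def order.order_iff_strict)

lemma biword_of_unique:
  assumes "finite {x. 0 < m x}"
  shows "biword w \<and> count (mset w) = m \<longleftrightarrow> w = biword_of m"
proof -
  have "count (Abs_multiset m) = m"
    using assms by simp
  then have "count (mset w) = m \<longleftrightarrow> mset w = Abs_multiset m"
    by (metis count_inverse)
  then show ?thesis
    unfolding biword_of_def biword_iff_sorted
    by (metis mset_sorted_list_of_multiset sorted_list_of_multiset_mset
        sorted_sorted_list_of_multiset sorted_sort sorted_sort_id)
qed

text \<open>Row insertion returns the new row and the bumped entry, if any.\<close>

fun row_insert :: "'a::linorder \<Rightarrow> 'a list \<Rightarrow> 'a list \<times> 'a option" where
  "row_insert x [] = ([x], None)"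
| "row_insert x (y # ys) =
     (if x < y then (x # ys, Some y)
      else (case row_insert x ys of (r, b) \<Rightarrow> (y # r, b)))"

text \<open>\<open>tableau_insert x T\<close> is the new tableau with the (0-based) row of the box created.\<close>

fun tableau_insert :: "'a::linorder \<Rightarrow> 'a tableau \<Rightarrow> 'a tableau \<times> nat" where
  "tableau_insert x [] = ([[x]], 0)"
| "tableau_insert x (r # T) =
     (case row_insert x r of
        (r', None) \<Rightarrow> (r' # T, 0)
      | (r', Some y) \<Rightarrow> (case tableau_insert y T of (T', k) \<Rightarrow> (r' # T', Suc k)))"

definition place :: "'a \<Rightarrow> nat \<Rightarrow> 'a tableau \<Rightarrow> 'a tableau" where
  "place a k Q = (if k < length Q then Q[k := Q ! k @ [a]] else Q @ [[a]])"

definition rsk_step ::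
  "'a \<times> 'b::linorder \<Rightarrow> 'b tableau \<times> 'a tableau \<Rightarrow> 'b tableau \<times> 'a tableau" where
  "rsk_step = (\<lambda>(a, b) (P, Q). case tableau_insert b P of (P', k) \<Rightarrow> (P', place a k Q))"

definition rsk :: "('a \<times> 'b::linorder) list \<Rightarrow> 'b tableau \<times> 'a tableau" where
  "rsk w = fold rsk_step w ([], [])"

definition matrices_with_sums :: "nat list \<Rightarrow> nat list \<Rightarrow> (nat \<Rightarrow> nat \<Rightarrow> nat) set" where
  "matrices_with_sums \<rho> \<gamma> = {M \<in> nat_matrices.
     \<forall>t\<ge>1. (\<Sum>j. M t j) = part \<rho> t \<and> (\<Sum>i. M i t) = part \<gamma> t}"

definition rsk_matrix :: "(nat \<Rightarrow> nat \<Rightarrow> nat) \<Rightarrow> nat tableau \<times> nat tableau" where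
  "rsk_matrix M = rsk (biword_of (\<lambda>(i, j). M i j))"

section \<open>The map \<open>\<Psi>\<close>\<close>

text \<open>
  The list \<open>a # \<eta>\<close>, read from position 0 and continued by 0, is \<open>\<eta>\<close> with the convention
  \<open>\<eta>\<^sub>0 = a\<close>.
\<close>

definition Psi_biword :: "nat \<Rightarrow> parmat \<Rightarrow> nat \<Rightarrow> (letter \<times> letter) list" where
  "Psi_biword l = (\<lambda>(A, P) t. biword_of (\<lambda>((p, i), (q, j)).
     if (p, q) \<in> blocks l \<and> 1 \<le> i \<and> 1 \<le> j
     then (let \<eta> = nth_default 0 (A (p, q) i j # P (p, q) i j) in \<eta> (t - 1) - \<eta> t)
     else 0))"

definition Psi :: "nat \<Rightarrow> parmat \<Rightarrow> letter tableau list \<times> letter tableau list" where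
  "Psi l X = (map (\<lambda>t. fst (rsk (Psi_biword l X t))) [1..<Suc l],
              map (\<lambda>t. snd (rsk (Psi_biword l X t))) [1..<Suc l])"

text \<open>The identification of the number \<open>a\<close> with the letter \<open>a\<^sub>1\<close>.\<close>

definition to_letters :: "nat tableau \<Rightarrow> letter tableau" where
  "to_letters T = map (map (\<lambda>a. letter a 1)) T"

end

theory Submission
  imports Defs
begin

text \<open>
  RSK is inverted one letter at a time. The letter inserted last is recovered from the recording
  tableau, because equal entries of the upper row fill a horizontal strip from left to right
  (the row bumping lemma), so the last box is the topmost row end carrying the maximal entry;
  reverse insertion from a corner exists and is unique. A cell \<open>(a, \<eta>)\<close> of a pair \<open>(A, P)\<close> is
  equivalent to its sequence of consecutive differences \<open>\<eta>\<^sub>t\<^sub>-\<^sub>1 - \<eta>\<^sub>t\<close>, which are the multiplicities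
  in the biwords and sum to \<open>a\<close> by telescoping, while the bound on the length of \<open>\<eta>\<close> says that the
  \<open>t\<close>-th biword only involves letters with subscripts at least \<open>t\<close>. So row and column sums become
  contents, and RSK is applied in each component.
\<close>

section \<open>Row insertion\<close>

text \<open>The two halves of the row bumping lemma serve different purposes. Weakly increasing
  lower letters create boxes in weakly higher rows, and this makes the last box recognisable in the
  recording tableau. Strictly decreasing ones create boxes in strictly lower rows, and this forces
  the columns recovered by reverse insertion to come out in biword order. Contents play no part
  here, so the correspondence for a single word holds over arbitrary linear orders;
  \<open>biword_tuples\<close> is the set in the middle, where subscript bounds and contents are
  imposed. On the matrix side the differences are truncated subtractions, so telescoping rests on
  the profile of a cell being decreasing; its inverse is summation over a tail. The two special
  cases need little more. If the last components are empty, the last biword is empty because its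
  letters would need a subscript that does not occur. At level one, RSK commutes with strictly
  increasing relabelling, and the usual correspondence is transported from the general one.\<close>

lemma row_insert_None_iff:
  "row_insert x r = (r', None) \<longleftrightarrow> r' = r @ [x] \<and> (\<forall>z\<in>set r. z \<le> x)"
proof (induction r arbitrary: r')
  case (Cons a r)
  obtain s b where "row_insert x r = (s, b)" by fastforce
  with Cons.IH[of s] Cons.IH[of "r @ [x]"] show ?case by auto
qed auto

lemma row_insert_SomeD:
  assumes "row_insert x r = (r', Some y)"
  obtains u v where "r = u @ y # v" "r' = u @ x # v" "\<forall>z\<in>set u. z \<le> x" "x < y"
proof -
  have "\<exists>u v. r = u @ y # v \<and> r' = u @ x # v \<and> (\<forall>z\<in>set u. z \<le> x) \<and> x < y"
    using assms
  proof (induction r arbitrary: r')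
    case (Cons a r)
    show ?case
    proof (cases "x < a")
      case True
      with Cons.prems have "a # r = [] @ y # r" "r' = [] @ x # r" "x < y" by auto
      then show ?thesis by (metis empty_iff empty_set)
    next
      case False
      with Cons.prems obtain s where s: "row_insert x r = (s, Some y)" "r' = a # s"
        by (auto split: prod.splits)
      from Cons.IH[OF s(1)] obtain u v where
        "r = u @ y # v" "s = u @ x # v" "\<forall>z\<in>set u. z \<le> x" "x < y" by blast
      with False s(2) have "a # r = (a # u) @ y # v \<and> r' = (a # u) @ x # v \<and>
          (\<forall>z\<in>set (a # u). z \<le> x) \<and> x < y" by auto
      then show ?thesis by blast
    qed
  qed simp
  then show thesis using that by blast
qed

lemma row_insert_Some:
  "\<forall>z\<in>set u. z \<le> x \<Longrightarrow> x < y \<Longrightarrow> row_insert x (u @ y # v) = (u @ x # v, Some y)"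
  by (induction u) auto

text \<open>The position of the new entry, with \<open>i = length r\<close> standing for an append.
  Comparing adjacent rows column by column needs this position rather than a splitting
  \<open>u @ y # v\<close>.\<close>

lemma row_insert_upd:
  assumes "row_insert x r = (r', b)"
  obtains i where "i \<le> length r" "\<forall>j<i. r ! j \<le> x"
    "i < length r \<Longrightarrow> x < r ! i \<and> b = Some (r ! i) \<and> r' = r[i := x]"
    "i = length r \<Longrightarrow> b = None \<and> r' = r @ [x]"
proof (cases b)
  case None
  with assms show ?thesis
    by (intro that[of "length r"]) (auto simp: row_insert_None_iff)
next
  case (Some y)
  with assms obtain u v where
    "r = u @ y # v" "r' = u @ x # v" "\<forall>z\<in>set u. z \<le> x" "x < y"
    by (auto elim: row_insert_SomeD)
  with Some show ?thesis
    by (intro that[of "length u"]) (auto simp: nth_append)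
qed

lemma sorted_row_insert:
  assumes "sorted r" "row_insert x r = (r', b)"
  shows "sorted r'"
proof (cases b)
  case None
  with assms show ?thesis by (auto simp: row_insert_None_iff sorted_append)
next
  case (Some y)
  with assms obtain u v where
    "r = u @ y # v" "r' = u @ x # v" "\<forall>z\<in>set u. z \<le> x" "x < y"
    by (auto elim: row_insert_SomeD)
  with assms show ?thesis by (force simp: sorted_append)
qed

text \<open>Since \<open>x \<le> y\<close>, the second insertion passes the cell now holding
  \<open>x\<close>. If \<open>x\<close> had been appended, \<open>y\<close> would be appended after
  it; otherwise \<open>y\<close> bumps an entry to the right of the one bumped by \<open>x\<close>,
  and sortedness compares the two.\<close>

lemma row_bump_le:
  assumes "sorted r" "row_insert x r = (r', b)" "row_insert y r' = (r'', Some z')" "x \<le> y"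
  obtains z where "b = Some z" "z \<le> z'"
proof -
  have "\<exists>z. b = Some z \<and> z \<le> z'"
    using assms
  proof (induction r arbitrary: r' r'')
    case (Cons a r)
    show ?case
    proof (cases "x < a")
      case True
      with Cons.prems(2,3,4) obtain s where s: "row_insert y r = (s, Some z')"
        by (auto split: prod.splits if_splits dest: leD)
      then have "z' \<in> set r" by (auto elim: row_insert_SomeD)
      with Cons.prems(1,2) True show ?thesis by auto
    next
      case False
      then show ?thesis using Cons by (auto split: prod.splits if_splits)
    qed
  qed (auto split: if_splits dest: leD)
  then show thesis using that by blast
qed

text \<open>The entry \<open>x\<close>, now in the row, exceeds \<open>y\<close>, so
  \<open>y\<close> certainly bumps something, and does so no further right than \<open>x\<close>.
  Everything up to that cell is at most \<open>x\<close>, whereas \<open>x\<close> bumped something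
  larger than itself.\<close>

lemma row_bump_less:
  assumes "row_insert x r = (r', b)" "row_insert y r' = (r'', b')" "y < x"
  obtains z' where "b' = Some z'" "\<And>z. b = Some z \<Longrightarrow> z' < z"
proof -
  have "\<exists>z'. b' = Some z' \<and> (\<forall>z. b = Some z \<longrightarrow> z' < z)"
    using assms
  proof (induction r arbitrary: r' r'')
    case (Cons a r)
    show ?case
    proof (cases "x < a")
      case True
      with Cons.prems show ?thesis by auto
    next
      case False
      with Cons.prems(1) obtain s where s: "row_insert x r = (s, b)" "r' = a # s"
        by (auto split: prod.splits)
      show ?thesis
      proof (cases "y < a")
        case True
        have "a < z" if "b = Some z" for z
          using that s(1) False by (auto elim!: row_insert_SomeD)
        with True s Cons.prems(2) show ?thesis by auto
      next
        case False
        with s Cons show ?thesis by (auto split: prod.splits)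
      qed
    qed
  qed auto
  then show thesis using that by blast
qed

section \<open>Semistandard tableaux, row by row\<close>

definition column_less :: "'a::linorder list \<Rightarrow> 'a list \<Rightarrow> bool" where
  "column_less r s \<longleftrightarrow> length s \<le> length r \<and> (\<forall>j<length s. r ! j < s ! j)"

lemma semistandard_Nil [simp]: "semistandard []"
  by (simp add: semistandard_def is_partition_def shape_def)

text \<open>Replaces the condition quantified over all row and column indices by one between
  neighbouring rows, so that later proofs can follow the recursion of \<open>tableau_insert\<close>
  along the list of rows.\<close>

lemma semistandard_Cons:
  "semistandard (r # T) \<longleftrightarrow>
     r \<noteq> [] \<and> sorted r \<and> (T \<noteq> [] \<longrightarrow> column_less r (hd T)) \<and> semistandard T"
proof (cases T)
  case Nil
  then show ?thesis by (auto simp: semistandard_def is_partition_def shape_def)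
next
  case (Cons s T')
  have columns: "(\<forall>i j. Suc i < length (r # T) \<and> j < length ((r # T) ! Suc i) \<longrightarrow>
        (r # T) ! i ! j < (r # T) ! Suc i ! j) \<longleftrightarrow>
      (\<forall>j<length s. r ! j < s ! j) \<and>
      (\<forall>i j. Suc i < length T \<and> j < length (T ! Suc i) \<longrightarrow> T ! i ! j < T ! Suc i ! j)"
    (is "?L \<longleftrightarrow> ?R1 \<and> ?R2")
  proof (intro iffI conjI allI impI; (elim conjE)?)
    fix j assume ?L "j < length s"
    then show "r ! j < s ! j" using Cons by fastforce
  next
    fix i j assume ?L "Suc i < length T" "j < length (T ! Suc i)"
    then show "T ! i ! j < T ! Suc i ! j" by (metis Suc_less_eq length_Cons nth_Cons_Suc)
  next
    fix i j assume "?R1" "?R2" "Suc i < length (r # T)" "j < length ((r # T) ! Suc i)"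
    then show "(r # T) ! i ! j < (r # T) ! Suc i ! j"
      using Cons by (cases i) auto
  qed
  have "is_partition (shape (r # T)) \<longleftrightarrow>
      r \<noteq> [] \<and> length s \<le> length r \<and> is_partition (shape T)"
    using Cons by (auto simp: is_partition_def shape_def)
  with columns show ?thesis
    unfolding semistandard_def[of "r # T"] semistandard_def[of T] columns
    by (auto simp: Cons column_less_def)
qed

lemma semistandard_nonempty_rows: "semistandard T \<Longrightarrow> r \<in> set T \<Longrightarrow> r \<noteq> []"
  by (auto simp: semistandard_def is_partition_def shape_def)

lemma shape_Nil [simp]: "shape [] = []" and shape_Cons [simp]: "shape (r # T) = length r # shape T"
  by (simp_all add: shape_def)

lemma length_shape [simp]: "length (shape T) = length T"
  by (simp add: shape_def)

lemma entries_Nil [simp]: "entries [] = {#}"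
  and entries_Cons [simp]: "entries (r # T) = mset r + entries T"
  by (simp_all add: entries_def)

lemma size_entries: "size (entries T) = sum_list (shape T)"
  by (induction T) auto

lemma in_entries_iff: "x \<in># entries T \<longleftrightarrow> (\<exists>r\<in>set T. x \<in> set r)"
  by (induction T) auto

section \<open>Insertion into a tableau\<close>

lemma tableau_insert_Cons_cases:
  assumes "tableau_insert x (r # T) = (T', k)"
  obtains
    (stop) r' where "row_insert x r = (r', None)" "T' = r' # T" "k = 0"
  | (bump) r' y T'' k' where "row_insert x r = (r', Some y)" "tableau_insert y T = (T'', k')"
      "T' = r' # T''" "k = Suc k'"
  using assms by (auto split: prod.splits option.splits)

lemma tableau_insert_hd:
  assumes "tableau_insert x T = (T', k)"
  shows "T' \<noteq> []" "T = [] \<Longrightarrow> T' = [[x]]" "T \<noteq> [] \<Longrightarrow> hd T' = fst (row_insert x (hd T))"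
proof -
  show "T' \<noteq> []" using assms by (cases T) (auto split: prod.splits option.splits)
  show "T = [] \<Longrightarrow> T' = [[x]]" using assms by simp
  show "T \<noteq> [] \<Longrightarrow> hd T' = fst (row_insert x (hd T))"
    using assms by (cases T) (auto split: prod.splits option.splits)
qed

text \<open>The entry below \<open>y\<close> in row \<open>s\<close> exceeds \<open>y\<close>, so \<open>y\<close> lands weakly left of its old column.\<close>

lemma column_less_row_insert:
  assumes "row_insert x r = (r', Some y)" "row_insert y s = (s', b)"
    "column_less r s" "sorted r"
  shows "column_less r' s'"
proof -
  from assms(1) obtain i where i: "i < length r" "\<forall>j<i. r ! j \<le> x" "x < r ! i" "y = r ! i"
    "r' = r[i := x]"
    by (rule row_insert_upd) (metis le_neq_implies_less option.distinct(1) option.inject)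
  from assms(2) obtain m where m: "m \<le> length s" "\<forall>j<m. s ! j \<le> y"
    "m < length s \<Longrightarrow> s' = s[m := y]" "m = length s \<Longrightarrow> s' = s @ [y]"
    by (rule row_insert_upd) auto
  have less: "r ! j < s ! j" if "j < length s" for j
    using that assms(3) by (auto simp: column_less_def)
  have len: "length s \<le> length r" using assms(3) by (simp add: column_less_def)
  have "m \<le> i"
  proof (rule ccontr)
    assume "\<not> m \<le> i"
    then have "s ! i \<le> y" "r ! i < s ! i" using m(1,2) less[of i] by auto
    with i(4) show False by simp
  qed
  have le: "r' ! j \<le> r ! j" for j
    using i by (cases "j = i") auto
  \<comment> \<open>Column \<open>m\<close> of the upper row now holds either the inserted
    \<open>x\<close>, or an entry to its left, which is at most \<open>x\<close>; and
    \<open>x < y\<close>.\<close>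
  have at_m: "r' ! m < y"
    using \<open>m \<le> i\<close> i le_less_trans[of "r ! m" x "r ! i"] by (cases "m = i") auto
  show ?thesis
  proof (cases "m < length s")
    case True
    have "r' ! j < s[m := y] ! j" if "j < length s" for j
      using that at_m le_less_trans[OF le less[OF that]] by (cases "j = m") auto
    with True m(3) len i(5) show ?thesis by (auto simp: column_less_def)
  next
    case False
    with m have "s' = s @ [y]" "m = length s" by auto
    moreover have "r' ! j < (s @ [y]) ! j" if "j \<le> length s" for j
      using that at_m le_less_trans[OF le less[of j]] \<open>m = length s\<close>
      by (cases "j = m") (auto simp: nth_append)
    ultimately show ?thesis
      using \<open>m \<le> i\<close> i(1,5) by (auto simp: column_less_def)
  qed
qed

lemma semistandard_tableau_insert:
  "semistandard T \<Longrightarrow> tableau_insert x T = (T', k) \<Longrightarrow> semistandard T'"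
proof (induction T arbitrary: x T' k)
  case Nil
  then show ?case by (auto simp: semistandard_Cons)
next
  case (Cons r T)
  from Cons.prems(1) have r: "r \<noteq> []" "sorted r" "semistandard T" "T \<noteq> [] \<Longrightarrow> column_less r (hd T)"
    by (auto simp: semistandard_Cons)
  from Cons.prems(2) show ?case
  proof (cases rule: tableau_insert_Cons_cases)
    case (stop r')
    then have "column_less r' s" if "column_less r s" for s
      using that by (auto simp: row_insert_None_iff column_less_def nth_append)
    moreover have "sorted r'" using sorted_row_insert r(2) stop(1) by blast
    ultimately show ?thesis using stop r by (auto simp: semistandard_Cons row_insert_None_iff)
  next
    case (bump r' y T'' k')
    have "semistandard T''" using Cons.IH[OF r(3) bump(2)] .
    moreover have "sorted r'" using sorted_row_insert r(2) bump(1) by blast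
    moreover have "r' \<noteq> []" using bump(1) by (auto elim: row_insert_SomeD)
    moreover have "column_less r' (hd T'')"
    proof (cases "T = []")
      case True
      then have "T'' = [[y]]" using tableau_insert_hd(2) bump(2) by blast
      moreover have "r' ! 0 < y"
      proof -
        from bump(1) obtain u v where "r' = u @ x # v" "\<forall>z\<in>set u. z \<le> x" "x < y"
          by (rule row_insert_SomeD)
        then show ?thesis by (cases u) auto
      qed
      ultimately show ?thesis using \<open>r' \<noteq> []\<close> by (cases r') (auto simp: column_less_def)
    next
      case False
      then show ?thesis
        using column_less_row_insert[OF bump(1) _ r(4) r(2)] tableau_insert_hd(3)[OF bump(2)]
        by (metis prod.collapse)
    qed
    ultimately show ?thesis using bump(3) by (auto simp: semistandard_Cons)
  qed
qed

lemma entries_tableau_insert: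
  "tableau_insert x T = (T', k) \<Longrightarrow> entries T' = add_mset x (entries T)"
proof (induction T arbitrary: x T' k)
  case (Cons r T)
  from Cons.prems show ?case
  proof (cases rule: tableau_insert_Cons_cases)
    case stop
    then show ?thesis by (auto simp: row_insert_None_iff)
  next
    case bump
    then show ?thesis using Cons.IH[OF bump(2)] by (auto elim!: row_insert_SomeD)
  qed
qed auto

text \<open>Only the row \<open>k\<close> of the new box matters, so \<open>Q\<close> is any tableau
  of the same shape: the recording tableau in the forward direction, and \<open>T\<close> itself
  when the step is undone.\<close>

lemma shape_tableau_insert:
  "tableau_insert x T = (T', k) \<Longrightarrow> shape Q = shape T \<Longrightarrow> shape T' = shape (place a k Q)"
proof (induction T arbitrary: x T' k Q)
  case Nil
  then show ?case by (auto simp: place_def shape_def)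
next
  case (Cons r T)
  from Cons.prems(2) obtain q Q' where Q: "Q = q # Q'" "length q = length r" "shape Q' = shape T"
    by (cases Q) auto
  from Cons.prems(1) show ?case
  proof (cases rule: tableau_insert_Cons_cases)
    case stop
    with Q show ?thesis by (auto simp: row_insert_None_iff place_def)
  next
    case (bump r' y T'' k')
    have "length r' = length r" using bump(1) by (auto elim!: row_insert_SomeD)
    with Q bump Cons.IH[OF bump(2) Q(3)] show ?thesis by (auto simp: place_def split: if_splits)
  qed
qed

lemma tableau_insert_index: "tableau_insert x T = (T', k) \<Longrightarrow> k \<le> length T"
  by (induction T arbitrary: x T' k) (auto split: prod.splits option.splits)

text \<open>By \<open>row_bump_le\<close>, whenever the second insertion bumps out of a row, so does
  the first, and the two bumped entries are again weakly increasing. Hence the second path stops no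
  later than the first.\<close>

lemma bumping_weak:
  assumes "\<forall>r\<in>set T. sorted r" "tableau_insert x T = (T', k)" "tableau_insert y T' = (T'', k')"
    "x \<le> y"
  shows "k' \<le> k"
  using assms
proof (induction T arbitrary: x y T' T'' k k')
  case Nil
  then show ?case by (auto split: if_splits)
next
  case (Cons r T)
  from Cons.prems(2) obtain r' b where r': "row_insert x r = (r', b)" "hd T' = r'"
    using tableau_insert_hd by (metis eq_fst_iff list.discI list.sel(1))
  from tableau_insert_hd(1)[OF Cons.prems(2)] have T': "T' = r' # tl T'" using r' by auto
  show ?case
  proof (cases k')
    case (Suc k1')
    with Cons.prems(3) T' have "tableau_insert y (r' # tl T') = (T'', Suc k1')" by simp
    then obtain r'' z' T1'' where 2: "row_insert y r' = (r'', Some z')"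
      "tableau_insert z' (tl T') = (T1'', k1')"
      by (rule tableau_insert_Cons_cases) auto
    from Cons.prems(1) r'(1) 2(1) Cons.prems(4) obtain z where z: "b = Some z" "z \<le> z'"
      by (auto elim: row_bump_le)
    from Cons.prems(2) obtain k1 where "tableau_insert z T = (tl T', k1)" "k = Suc k1"
      by (rule tableau_insert_Cons_cases) (use r' z in auto)
    with Cons.IH[OF _ _ 2(2) z(2)] Cons.prems(1) Suc show ?thesis by auto
  qed simp
qed

text \<open>By \<open>row_bump_less\<close>, the second insertion bumps out of every row that the
  first one reaches, including the row where the first one stops; so it ends at least one row
  lower.\<close>

lemma bumping_strict:
  assumes "tableau_insert x T = (T', k)" "tableau_insert y T' = (T'', k')" "y < x"
  shows "k < k'"
  using assms
proof (induction T arbitrary: x y T' T'' k k')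
  case Nil
  then show ?case by (auto split: if_splits)
next
  case (Cons r T)
  from Cons.prems(1) obtain r' b where r': "row_insert x r = (r', b)" "hd T' = r'"
    using tableau_insert_hd by (metis eq_fst_iff list.discI list.sel(1))
  from tableau_insert_hd(1)[OF Cons.prems(1)] have T': "T' = r' # tl T'" using r' by auto
  obtain r'' b' where r'': "row_insert y r' = (r'', b')" by fastforce
  from row_bump_less[OF r'(1) r'' Cons.prems(3)] obtain z' where
    z': "b' = Some z'" "\<And>z. b = Some z \<Longrightarrow> z' < z" by blast
  with Cons.prems(2) T' r'' obtain T1'' k1' where 2: "tableau_insert z' (tl T') = (T1'', k1')"
      "k' = Suc k1'"
    by (metis Pair_inject option.distinct(1) option.inject tableau_insert_Cons_cases)
  show ?case
  proof (cases b)
    case None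
    with Cons.prems(1) r' show ?thesis by (simp add: 2)
  next
    case (Some z)
    from Cons.prems(1) obtain k1 where "tableau_insert z T = (tl T', k1)" "k = Suc k1"
      by (rule tableau_insert_Cons_cases) (use r' Some in auto)
    with Cons.IH[OF _ 2(1) z'(2)[OF Some]] 2(2) show ?thesis by auto
  qed
qed

section \<open>Reverse insertion\<close>

text \<open>Undoing a bump moves \<open>y\<close> from the lower row up to the cell of
  \<open>x\<close>. The entry above \<open>y\<close> is smaller than \<open>y\<close> while all of
  \<open>v\<close> is at least \<open>y\<close>, so \<open>y\<close> comes from a column
  \<open>i \<le> length u\<close>. In its new column the entry below is at least
  \<open>s' ! i\<close>, which exceeds \<open>y\<close>.\<close>

lemma column_less_reverse_row_insert:
  assumes "row_insert y s' = (s, b)" "sorted s'" "column_less (u @ x # v) s"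
    "x < y" "\<forall>z\<in>set v. y \<le> z"
  shows "column_less (u @ y # v) s'"
proof -
  let ?r = "u @ x # v" and ?r' = "u @ y # v"
  from assms(1) obtain i where i: "i \<le> length s'"
    "i < length s' \<Longrightarrow> y < s' ! i \<and> s = s'[i := y]" "i = length s' \<Longrightarrow> s = s' @ [y]"
    by (rule row_insert_upd) auto
  have "length s' \<le> length s" "i < length s" "s ! i = y"
    using i by (cases "i < length s'"; auto)+
  moreover have less: "?r ! j < s ! j" if "j < length s" for j
    using that assms(3) by (auto simp: column_less_def)
  ultimately have at_i: "?r ! i < y" by metis
  have len: "length s \<le> length ?r" using assms(3) by (simp add: column_less_def)
  have "i \<le> length u"
  proof (rule ccontr)
    assume "\<not> i \<le> length u"
    then obtain d where d: "i = Suc (length u + d)" by (metis less_iff_Suc_add not_le)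
    with \<open>i < length s\<close> len have "d < length v" by simp
    with assms(5) have "y \<le> v ! d" by simp
    with at_i d show False by (simp add: nth_append)
  qed
  have "?r' ! j < s' ! j" if j: "j < length s'" for j
  proof (cases "j = length u")
    case True
    with \<open>i \<le> length u\<close> j have "y < s' ! i" "s' ! i \<le> s' ! j"
      using i(2) assms(2) by (auto simp: sorted_iff_nth_mono)
    with True show ?thesis by simp
  next
    case False
    then have r: "?r' ! j = ?r ! j" by (auto simp: nth_append nth_Cons split: nat.splits)
    show ?thesis
    proof (cases "j = i")
      case True
      with at_i i(2) j r show ?thesis by auto
    next
      case False
      then have "s ! j = s' ! j" using i j by (cases "i < length s'") (auto simp: nth_append)
      with less[of j] r j \<open>length s' \<le> length s\<close> show ?thesis by simp
    qed
  qed
  with len \<open>length s' \<le> length s\<close> show ?thesis by (auto simp: column_less_def)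
qed

text \<open>The last hypothesis says that row \<open>k\<close> ends in a corner of the shape, so its
  final box can be removed. The expelled letter then travels upwards, and in each row it takes the
  place of the rightmost entry smaller than itself.\<close>

lemma reverse_insertion_exists:
  assumes "semistandard P" "k < length P" "Suc k < length P \<Longrightarrow> length (P ! Suc k) < length (P ! k)"
  shows "\<exists>P' b. semistandard P' \<and> tableau_insert b P' = (P, k)"
  using assms
proof (induction P arbitrary: k)
  case (Cons r T)
  from Cons.prems(1) have r: "r \<noteq> []" "sorted r" "semistandard T" "T \<noteq> [] \<Longrightarrow> column_less r (hd T)"
    by (auto simp: semistandard_Cons)
  show ?case
  proof (cases k)
    case 0
    have T: "length (hd T) < length r" if "T \<noteq> []"
      using Cons.prems(3) 0 that by (cases T) auto
    have sorted_snoc: "sorted (butlast r @ [last r])" using r by simp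
    then have le_last: "sorted (butlast r)" "\<forall>z\<in>set (butlast r). z \<le> last r"
      unfolding sorted_append by simp_all
    show ?thesis
    proof (cases "butlast r = []")
      case True
      have "T = []"
      proof (rule ccontr)
        assume "T \<noteq> []"
        with T True semistandard_nonempty_rows[OF r(3), of "hd T"] show False
          by (cases r) (auto split: if_splits)
      qed
      with True 0 r(1) have "tableau_insert (last r) [] = (r # T, k)"
        by (cases r) (auto split: if_splits)
      then show ?thesis by (intro exI[of _ "[]"]) auto
    next
      case False
      have "row_insert (last r) (butlast r) = (r, None)"
        using r(1) le_last by (simp add: row_insert_None_iff)
      then have "tableau_insert (last r) (butlast r # T) = (r # T, k)" by (simp add: 0)
      moreover have "semistandard (butlast r # T)"
        using False r le_last T
        by (auto simp: semistandard_Cons column_less_def nth_butlast sorted_append)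
      ultimately show ?thesis by blast
    qed
  next
    case (Suc k')
    with Cons.prems(2,3) Cons.IH[OF r(3), of k'] obtain T' y where
      T': "semistandard T'" "tableau_insert y T' = (T, k')"
      by auto
    have "T \<noteq> []" using tableau_insert_hd(1)[OF T'(2)] .
    \<comment> \<open>The letter just inserted into \<open>T'\<close> stands in the first row of the
      result. The entry of \<open>r\<close> above it is smaller, so \<open>r\<close> contains an
      entry that \<open>y\<close> can displace.\<close>
    have "y \<in> set (hd T)"
    proof (cases "T' = []")
      case False
      obtain s b where s: "row_insert y (hd T') = (s, b)" by fastforce
      then have "y \<in> set s" by (cases b) (auto simp: row_insert_None_iff elim: row_insert_SomeD)
      then show ?thesis using s tableau_insert_hd(3)[OF T'(2) False] by simp
    qed (use tableau_insert_hd(2)[OF T'(2)] in simp)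
    then obtain i where "i < length (hd T)" "hd T ! i = y" by (auto simp: in_set_conv_nth)
    with r(4)[OF \<open>T \<noteq> []\<close>] have "\<exists>x\<in>set r. x < y"
      by (intro bexI[of _ "r ! i"]) (auto simp: column_less_def)
    \<comment> \<open>The last entry below \<open>y\<close> is taken: then everything after it is at
      least \<open>y\<close>, so the row with \<open>y\<close> in its place stays sorted, and
      inserting \<open>x\<close> bumps exactly \<open>y\<close>.\<close>
    then obtain u x v where uxv: "r = u @ x # v" "x < y" "\<forall>z\<in>set v. \<not> z < y"
      by (auto dest!: split_list_last_prop)
    let ?r' = "u @ y # v"
    have "row_insert x ?r' = (r, Some y)"
      using uxv r(2) by (simp add: row_insert_Some sorted_append)
    then have "tableau_insert x (?r' # T') = (r # T, k)" using T'(2) Suc by simp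
    moreover have "sorted ?r'"
      using uxv r(2) by (auto simp: sorted_append not_less intro: le_less_trans less_imp_le)
    moreover have "column_less ?r' (hd T')" if "T' \<noteq> []"
    proof (rule column_less_reverse_row_insert)
      show "row_insert y (hd T') = (hd T, snd (row_insert y (hd T')))"
        using tableau_insert_hd(3)[OF T'(2) that] by simp
      show "sorted (hd T')" using T'(1) that by (cases T') (auto simp: semistandard_Cons)
    qed (use r(4)[OF \<open>T \<noteq> []\<close>] uxv in \<open>auto simp: not_less\<close>)
    ultimately show ?thesis using T'(1) by (metis append_is_Nil_conv list.discI semistandard_Cons)
  qed
qed simp

text \<open>The lower rows determine the bumped letter by induction, and the bumped letter
  determines the cell: it is the last position of the new first row whose entry is below that
  letter.\<close>

lemma reverse_insertion_unique:
  assumes "semistandard P1" "semistandard P2"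
    "tableau_insert x1 P1 = (P, k)" "tableau_insert x2 P2 = (P, k)"
  shows "x1 = x2 \<and> P1 = P2"
  using assms
proof (induction P1 arbitrary: P2 x1 x2 P k)
  case Nil
  then show ?case by (cases P2) (auto simp: semistandard_Cons row_insert_None_iff
        elim: tableau_insert_Cons_cases split: prod.splits option.splits)
next
  case (Cons r1 T1)
  show ?case
  proof (cases P2)
    case Nil
    with Cons.prems show ?thesis by (auto simp: semistandard_Cons row_insert_None_iff
        split: prod.splits option.splits)
  next
    case (Cons r2 T2)
    from Cons.prems(3) show ?thesis
    proof (cases rule: tableau_insert_Cons_cases)
      case (stop r)
      from Cons.prems(4) have "row_insert x2 r2 = (r, None) \<and> T2 = T1"
        unfolding \<open>P2 = r2 # T2\<close> by (rule tableau_insert_Cons_cases) (use stop in auto)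
      with stop \<open>P2 = r2 # T2\<close> show ?thesis by (auto simp: row_insert_None_iff)
    next
      case (bump r y1 T k')
      from Cons.prems(4) obtain y2 where 2: "row_insert x2 r2 = (r, Some y2)"
          "tableau_insert y2 T2 = (T, k')"
        unfolding \<open>P2 = r2 # T2\<close> by (rule tableau_insert_Cons_cases) (use bump in auto)
      have sorted: "sorted r1" "sorted r2" "semistandard T1" "semistandard T2"
        using Cons.prems(1,2) \<open>P2 = r2 # T2\<close> by (auto simp: semistandard_Cons)
      with Cons.IH[OF _ _ bump(2) 2(2)] have T: "y1 = y2" "T1 = T2" by auto
      from bump(1) obtain u1 v1 where 1: "r1 = u1 @ y1 # v1" "r = u1 @ x1 # v1" "x1 < y1"
        by (rule row_insert_SomeD)
      from 2(1) T obtain u2 v2 where 2: "r2 = u2 @ y1 # v2" "r = u2 @ x2 # v2" "x2 < y1"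
        by (auto elim: row_insert_SomeD)
      \<comment> \<open>Everything right of the cell was already right of \<open>y1\<close> in a
        sorted row. Since \<open>x1\<close> and \<open>x2\<close> are both below \<open>y1\<close>,
        neither splitting of \<open>r\<close> can place its cell further left than the
        other.\<close>
      have "\<forall>z\<in>set v1. \<not> z < y1" "\<forall>z\<in>set v2. \<not> z < y1"
        using sorted 1 2 by (auto simp: sorted_append)
      moreover from this 1 2 have "x1 \<notin> set v2" "x2 \<notin> set v1" by auto
      ultimately have "u1 = u2 \<and> x1 = x2 \<and> v1 = v2"
        using 1(2,3) 2(2,3) by (auto simp: append_eq_append_conv2 Cons_eq_append_conv append_eq_Cons_conv)
      with 1 2 T \<open>P2 = r2 # T2\<close> show ?thesis by simp
    qed
  qed
qed

section \<open>The last box of the recording tableau\<close>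

text \<open>
  The largest entry occupies a horizontal strip; RSK fills the strip from left to right, so the
  box added last is the one in the topmost row.
\<close>

definition last_box :: "'a::linorder tableau \<Rightarrow> 'a \<Rightarrow> nat \<Rightarrow> bool" where
  "last_box Q a k \<longleftrightarrow> k < length Q \<and> last (Q ! k) = a \<and> (\<forall>x\<in>#entries Q. x \<le> a) \<and>
     (\<forall>i<k. last (Q ! i) \<noteq> a)"

lemma last_in_entries: "semistandard Q \<Longrightarrow> i < length Q \<Longrightarrow> last (Q ! i) \<in># entries Q"
  using semistandard_nonempty_rows[of Q "Q ! i"] last_in_set[of "Q ! i"] nth_mem[of i Q]
  unfolding in_entries_iff by blast

lemma last_box_unique:
  assumes "semistandard Q" "last_box Q a k" "last_box Q b m"
  shows "a = b" "k = m"
proof -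
  have "a \<in># entries Q" "b \<in># entries Q"
    using assms last_in_entries[OF assms(1)] by (auto simp: last_box_def)
  with assms show "a = b" by (auto simp: last_box_def intro: antisym)
  with assms show "k = m" unfolding last_box_def by (metis linorder_neqE_nat)
qed

lemma last_box_exists:
  assumes "semistandard Q" "Q \<noteq> []"
  obtains a k where "last_box Q a k"
proof -
  let ?a = "Max (set_mset (entries Q))"
  have max: "x \<le> ?a" if "x \<in># entries Q" for x using that by simp
  have "entries Q \<noteq> {#}"
    using last_in_entries[OF assms(1), of 0] assms(2) by auto
  then have "?a \<in># entries Q" by (intro Max_in) auto
  then obtain r where r: "r \<in> set Q" "?a \<in> set r" by (auto simp: in_entries_iff)
  then have "sorted r" using assms(1) by (auto simp: semistandard_def)
  have "r \<noteq> []" using r by auto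
  with \<open>sorted r\<close> r(2) have "?a \<le> last r"
    by (cases r rule: rev_cases) (auto simp: sorted_append)
  moreover have "last r \<in># entries Q"
    using r(1) \<open>r \<noteq> []\<close> unfolding in_entries_iff by (intro bexI[of _ r]) auto
  ultimately have "last r = ?a" using max by (intro antisym)
  define box where "box j \<longleftrightarrow> j < length Q \<and> last (Q ! j) = ?a" for j
  obtain j where "box j"
    using r(1) \<open>last r = ?a\<close> by (auto simp: in_set_conv_nth box_def)
  then have "box (Least box)" by (rule LeastI)
  moreover have "\<not> box i" if "i < Least box" for i
    using that by (rule not_less_Least)
  ultimately have "last_box Q ?a (Least box)"
    using max unfolding last_box_def box_def by (meson less_trans)
  then show thesis using that by blast
qed

lemma last_box_Cons:
  "last_box (r # T) a k \<longleftrightarrow> (\<forall>x\<in>set r \<union> set_mset (entries T). x \<le> a) \<and>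
     (case k of 0 \<Rightarrow> last r = a | Suc k' \<Rightarrow> last r \<noteq> a \<and> last_box T a k')"
  by (cases k) (auto simp: last_box_def less_Suc_eq_0_disj)

text \<open>The two claims are proved together: the shortened row must still be at least as long as
  the next one, which is the corner property. That property is also what reverse insertion in the
  other tableau requires.\<close>

lemma last_box_remove:
  assumes "semistandard Q" "last_box Q a k"
  shows "\<exists>Q'. semistandard Q' \<and> k \<le> length Q' \<and> Q = place a k Q'"
    and "Suc k < length Q \<Longrightarrow> length (Q ! Suc k) < length (Q ! k)"
proof -
  have "(\<exists>Q'. semistandard Q' \<and> k \<le> length Q' \<and> Q = place a k Q') \<and>
    (Suc k < length Q \<longrightarrow> length (Q ! Suc k) < length (Q ! k))"
    using assms
  proof (induction Q arbitrary: k)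
    case Nil
    then show ?case by (simp add: last_box_def)
  next
    case (Cons r T)
    from Cons.prems(1) have r: "r \<noteq> []" "sorted r" "semistandard T" "T \<noteq> [] \<Longrightarrow> column_less r (hd T)"
      by (auto simp: semistandard_Cons)
    show ?case
    proof (cases k)
      case 0
      with Cons.prems(2) have a: "last r = a" "\<And>x. x \<in># entries T \<Longrightarrow> x \<le> a"
        by (auto simp: last_box_Cons)
      \<comment> \<open>An entry directly below the last box of \<open>r\<close> would be larger
        than \<open>a\<close>, which is the maximum.\<close>
      have T: "length (hd T) < length r" if "T \<noteq> []"
      proof (rule ccontr)
        assume "\<not> length (hd T) < length r"
        then have "length r - 1 < length (hd T)" using r(1) by (cases r) auto
        moreover from this have "a < hd T ! (length r - 1)"
          using r(1) r(4)[OF that] a(1) by (auto simp: column_less_def last_conv_nth)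
        moreover from \<open>length r - 1 < length (hd T)\<close> have "hd T ! (length r - 1) \<in># entries T"
          using that by (auto simp: in_entries_iff intro!: bexI[of _ "hd T"])
        ultimately show False using a(2) by fastforce
      qed
      have r_eq: "r = butlast r @ [a]" using r(1) a(1) by auto
      show ?thesis
      proof (cases "butlast r = []")
        case True
        have "T = []"
        proof (rule ccontr)
          assume "T \<noteq> []"
          with T True semistandard_nonempty_rows[OF r(3), of "hd T"] show False
            by (cases r) (auto split: if_splits)
        qed
        with True r_eq 0 show ?thesis by (intro conjI exI[of _ "[]"]) (auto simp: place_def)
      next
        case False
        have "sorted (butlast r @ [a])" using r(2) r_eq by simp
        with False r T have "semistandard (butlast r # T)"
          by (auto simp: semistandard_Cons column_less_def nth_butlast sorted_append)
        moreover have "r # T = place a k (butlast r # T)"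
          using 0 r_eq by (simp add: place_def)
        moreover have "Suc k < length (r # T) \<longrightarrow>
            length ((r # T) ! Suc k) < length ((r # T) ! k)"
          using T 0 by (cases T) auto
        ultimately show ?thesis using 0 by (metis le0)
      qed
    next
      case (Suc k')
      with Cons.prems(2) have "last_box T a k'" by (simp add: last_box_Cons)
      with Cons.IH[OF r(3)] obtain T' where T': "semistandard T'" "k' \<le> length T'"
          "T = place a k' T'"
        and corner: "Suc k' < length T \<longrightarrow> length (T ! Suc k') < length (T ! k')"
        by blast
      have "column_less r (hd T')" if ne: "T' \<noteq> []"
      proof -
        obtain z where "hd T = hd T' @ z"
          \<comment> \<open>Placing a box either extends the first row or leaves it alone, so
            \<open>hd T'\<close> is a prefix of \<open>hd T\<close> and inherits the column
            condition under \<open>r\<close>.\<close>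
          using T'(3) ne by (cases T'; cases k') (auto simp: place_def)
        moreover have "T \<noteq> []" using T'(3) by (auto simp: place_def split: if_splits)
        ultimately have "column_less r (hd T' @ z)" using r(4) by simp
        moreover from this have "r ! j < hd T' ! j" if "j < length (hd T')" for j
          using that by (auto simp: column_less_def nth_append dest!: spec[of _ j])
        ultimately show ?thesis by (simp add: column_less_def)
      qed
      with r T'(1) have "semistandard (r # T')" by (auto simp: semistandard_Cons)
      moreover have "r # T = place a k (r # T')" using T'(3) Suc by (auto simp: place_def)
      moreover have "k \<le> length (r # T')" using Suc T'(2) by simp
      moreover have "Suc k < length (r # T) \<longrightarrow>
          length ((r # T) ! Suc k) < length ((r # T) ! k)"
        using corner Suc by simp
      ultimately show ?thesis by blast
    qed
  qed
  then show "\<exists>Q'. semistandard Q' \<and> k \<le> length Q' \<and> Q = place a k Q'"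
    "Suc k < length Q \<Longrightarrow> length (Q ! Suc k) < length (Q ! k)" by auto
qed

text \<open>Converse of \<open>last_box_remove\<close>. The partition hypothesis makes the box
  addable; the rows above it do not end in the maximum \<open>a\<close>, so all their entries are
  smaller than \<open>a\<close> and column strictness survives.\<close>

lemma last_box_place:
  assumes "semistandard Q" "\<And>x. x \<in># entries Q \<Longrightarrow> x \<le> a" "k \<le> length Q"
    "is_partition (shape (place a k Q))" "\<And>i. i < k \<Longrightarrow> last (Q ! i) \<noteq> a"
  shows "semistandard (place a k Q) \<and> last_box (place a k Q) a k"
  using assms
proof (induction Q arbitrary: k)
  case Nil
  then show ?case by (auto simp: place_def semistandard_Cons last_box_def)
next
  case (Cons r T)
  from Cons.prems(1) have r: "r \<noteq> []" "sorted r" "semistandard T" "T \<noteq> [] \<Longrightarrow> column_less r (hd T)"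
    by (auto simp: semistandard_Cons)
  show ?case
  proof (cases k)
    case 0
    then have *: "place a k (r # T) = (r @ [a]) # T" by (simp add: place_def)
    have "column_less (r @ [a]) (hd T)" if "T \<noteq> []"
      using r(4)[OF that] by (auto simp: column_less_def nth_append)
    with r Cons.prems(2) show ?thesis
      unfolding * by (auto simp: semistandard_Cons last_box_Cons sorted_append 0)
  next
    case (Suc k')
    then have *: "place a k (r # T) = r # place a k' T" by (auto simp: place_def)
    from Cons.prems(4) have part: "is_partition (shape (place a k' T))"
      and len: "\<And>s. s \<in> set (place a k' T) \<Longrightarrow> length s \<le> length r"
      unfolding * by (auto simp: is_partition_def shape_def)
    have "last (T ! i) \<noteq> a" if "i < k'" for i
      using Cons.prems(5)[of "Suc i"] that Suc by simp
    with Cons.IH[OF r(3), of k'] Cons.prems(2,3) part Suc have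
      IH: "semistandard (place a k' T)" "last_box (place a k' T) a k'" by auto
    have "last r \<noteq> a" using Cons.prems(5)[of 0] Suc by simp
    have less_a: "x < a" if "x \<in> set r" for x
    proof -
      have "x \<le> last r" using that r(2) by (cases r rule: rev_cases) (auto simp: sorted_append)
      also have "last r < a" using \<open>last r \<noteq> a\<close> Cons.prems(2)[of "last r"] r(1) by auto
      finally show ?thesis .
    qed
    have "column_less r (hd (place a k' T))"
    proof (cases k')
      case 0
      then have hd: "hd (place a k' T) = (if T = [] then [] else hd T) @ [a]"
        by (cases T) (auto simp: place_def)
      have "place a k' T \<noteq> []" by (auto simp: place_def)
      moreover have "r ! 0 \<in> set r" using r(1) by simp
      ultimately show ?thesis
        using len[OF hd_in_set[of "place a k' T"]] hd less_a r(4)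
        by (auto simp: column_less_def nth_append split: if_splits)
    next
      case (Suc k'')
      with Cons.prems(3) \<open>k = Suc k'\<close> obtain s S where "T = s # S" by (cases T) auto
      then have "hd (place a k' T) = hd T" using Suc by (auto simp: place_def)
      with r(4) \<open>T = s # S\<close> show ?thesis by simp
    qed
    moreover have "x \<le> a" if "x \<in># entries (place a k' T)" for x
      using IH(2) that by (auto simp: last_box_def)
    ultimately show ?thesis
      unfolding * using IH r \<open>last r \<noteq> a\<close> Cons.prems(2) Suc
      by (auto simp: semistandard_Cons last_box_Cons)
  qed
qed

lemma entries_place: "entries (place a k Q) = add_mset a (entries Q)"
proof (cases "k < length Q")
  case True
  then show ?thesis
  proof (induction Q arbitrary: k)
    case (Cons r T)
    then show ?case by (cases k) (auto simp: place_def)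
  qed simp
next
  case False
  then show ?thesis by (simp add: place_def entries_def)
qed

lemma place_inject:
  assumes "shape Q1 = shape Q2" "place a k Q1 = place a k Q2"
  shows "Q1 = Q2"
proof -
  have "length Q1 = length Q2" using assms(1) by (metis length_shape)
  from this assms show ?thesis
  proof (induction Q1 Q2 arbitrary: k rule: list_induct2)
    case (Cons r1 T1 r2 T2)
    from Cons.IH[of "k - 1"] Cons.prems Cons.hyps show ?case
      by (cases k) (auto simp: place_def split: if_splits)
  qed simp
qed

text \<open>Undoing the same box in two tableaux of equal shape leaves equal shapes. Empty rows are
  excluded because a box put into an empty last row and a box opening a new row produce the same
  shape.\<close>

lemma shape_place_inject:
  assumes "shape (place a k Q1) = shape (place b k Q2)" "[] \<notin> set Q1" "[] \<notin> set Q2"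
    "k \<le> length Q1" "k \<le> length Q2"
  shows "shape Q1 = shape Q2"
  using assms
proof (induction Q1 arbitrary: k Q2)
  case Nil
  then show ?case by (cases Q2) (auto simp: place_def)
next
  case (Cons r1 T1)
  show ?case
  proof (cases Q2)
    case Nil
    with Cons show ?thesis by (cases r1; auto simp: place_def)
  next
    case (Cons r2 T2)
    with Cons.prems Cons.IH[of "k - 1" T2] show ?thesis
      by (cases k) (auto simp: place_def split: if_splits)
  qed
qed

section \<open>The RSK correspondence\<close>

lemma rsk_Nil [simp]: "rsk [] = ([], [])"
  by (simp add: rsk_def)

lemma rsk_snoc:
  "rsk (w @ [(a, b)]) = (case rsk w of (P, Q) \<Rightarrow>
     case tableau_insert b P of (P', k) \<Rightarrow> (P', place a k Q))"
  by (simp add: rsk_def rsk_step_def split: prod.splits)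

lemma entries_rsk:
  "entries (fst (rsk w)) = mset (map snd w)" "entries (snd (rsk w)) = mset (map fst w)"
proof (induction w rule: rev_induct)
  case (snoc x w)
  obtain a b where x: "x = (a, b)" by fastforce
  {
    case 1
    with snoc show ?case
      by (auto simp: x rsk_snoc entries_tableau_insert split: prod.splits)
  next
    case 2
    with snoc show ?case
      by (auto simp: x rsk_snoc entries_place split: prod.splits)
  }
qed auto

text \<open>Invariant behind invertibility: after each step the box just created is the one that
  \<open>last_box\<close> singles out. The induction hypothesis is the same statement for the
  preceding column, whose box the new one is compared with.\<close>

lemma rsk_last_box:
  assumes "sorted (w @ [(a, b)])" "rsk w = (P, Q)" "tableau_insert b P = (P', k)"
  shows "semistandard P \<and> semistandard Q \<and> shape P = shape Q \<and> k \<le> length Q \<and>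
    semistandard (place a k Q) \<and> last_box (place a k Q) a k"
  using assms
proof (induction w arbitrary: a b P Q P' k rule: rev_induct)
  case Nil
  then show ?case
    by (auto simp: place_def last_box_def semistandard_Cons)
next
  case (snoc x w)
  obtain a' b' where x: "x = (a', b')" by fastforce
  obtain P0 Q0 where PQ0: "rsk w = (P0, Q0)" by fastforce
  obtain P1 k' where P1: "tableau_insert b' P0 = (P1, k')" by fastforce
  have P: "P = P1" and Q: "Q = place a' k' Q0"
    using snoc.prems(2) by (auto simp: x rsk_snoc PQ0 P1)
  have "sorted (w @ [(a', b')])" using snoc.prems(1) by (simp add: x sorted_append)
  from snoc.IH[OF this PQ0 P1] have IH: "semistandard P0" "shape P0 = shape Q0"
    "semistandard Q" "last_box Q a' k'" by (simp_all add: Q)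
  have "semistandard P" using IH(1) P1 P semistandard_tableau_insert by blast
  moreover have "shape P = shape Q"
    using shape_tableau_insert[OF P1 IH(2)[symmetric]] P Q by simp
  moreover have "k \<le> length Q"
    using tableau_insert_index[OF snoc.prems(3)] \<open>shape P = shape Q\<close> by (metis length_shape)
  moreover have "semistandard (place a k Q) \<and> last_box (place a k Q) a k"
  proof (rule last_box_place)
    have "(a', b') \<le> (a, b)" using snoc.prems(1) by (simp add: x sorted_append)
    then have ab: "a' \<le> a" "a' = a \<Longrightarrow> b' \<le> b" by (auto simp: less_eq_prod_def)
    show "x \<le> a" if "x \<in># entries Q" for x
      using that IH(4) ab(1) by (auto simp: last_box_def)
    show "is_partition (shape (place a k Q))"
      using semistandard_tableau_insert[OF \<open>semistandard P\<close> snoc.prems(3)]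
        shape_tableau_insert[OF snoc.prems(3)] \<open>shape P = shape Q\<close>
      by (metis semistandard_def)
    show "last (Q ! i) \<noteq> a" if "i < k" for i
    \<comment> \<open>If the upper letters agree, the biword order gives \<open>b' \<le> b\<close>,
      so the new box is weakly above the previous one, and no row above that ends in
      \<open>a\<close>. If they differ, every earlier upper letter is smaller than
      \<open>a\<close>.\<close>
    proof (cases "a' = a")
      case True
      have "\<forall>r\<in>set P0. sorted r" using IH(1) by (simp add: semistandard_def)
      from bumping_weak[OF this P1 snoc.prems(3)[unfolded P]] ab(2)[OF True] have "k \<le> k'" .
      with that IH(4) True show ?thesis by (auto simp: last_box_def)
    next
      case False
      from that \<open>k \<le> length Q\<close> have "last (Q ! i) \<in># entries Q"
        by (intro last_in_entries[OF IH(3)]) simp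
      with IH(4) False ab(1) show ?thesis by (auto simp: last_box_def)
    qed
  qed (use IH(3) \<open>k \<le> length Q\<close> in auto)
  ultimately show ?case using IH(3) by simp
qed

lemma rsk_semistandard:
  assumes "sorted w" "rsk w = (P, Q)"
  shows "semistandard P" "semistandard Q" "shape P = shape Q"
proof -
  have "semistandard P \<and> semistandard Q \<and> shape P = shape Q"
  proof (cases w rule: rev_cases)
    case Nil
    with assms show ?thesis by simp
  next
    case (snoc w' x)
    obtain a b where x: "x = (a, b)" by fastforce
    obtain P0 Q0 where PQ0: "rsk w' = (P0, Q0)" by fastforce
    obtain P1 k where P1: "tableau_insert b P0 = (P1, k)" by fastforce
    have P: "P = P1" "Q = place a k Q0"
      using assms(2) by (auto simp: snoc x rsk_snoc PQ0 P1)
    from rsk_last_box[OF assms(1)[unfolded snoc x] PQ0 P1] P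
    show ?thesis
      using semistandard_tableau_insert[OF _ P1] shape_tableau_insert[OF P1] by metis
  qed
  then show "semistandard P" "semistandard Q" "shape P = shape Q" by auto
qed

lemma rsk_inject:
  assumes "sorted w1" "sorted w2" "rsk w1 = rsk w2"
  shows "w1 = w2"
  using assms
proof (induction w1 arbitrary: w2 rule: rev_induct)
  case Nil
  then have "mset (map fst w2) = {#}" by (metis entries_rsk(2) entries_Nil rsk_Nil snd_conv)
  then show ?case by simp
next
  case (snoc x1 w1)
  have "w2 \<noteq> []"
  proof
    assume "w2 = []"
    with snoc.prems(3) have "mset (map fst (w1 @ [x1])) = {#}"
      by (metis entries_rsk(2) entries_Nil rsk_Nil snd_conv)
    then show False by simp
  qed
  then obtain v2 x2 where w2: "w2 = v2 @ [x2]" by (metis rev_exhaust)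
  obtain a1 b1 a2 b2 where x: "x1 = (a1, b1)" "x2 = (a2, b2)" by fastforce
  obtain P1 Q1 P2 Q2 where PQ: "rsk w1 = (P1, Q1)" "rsk v2 = (P2, Q2)" by fastforce
  obtain P1' k1 P2' k2 where ins:
    "tableau_insert b1 P1 = (P1', k1)" "tableau_insert b2 P2 = (P2', k2)" by fastforce
  note box1 = rsk_last_box[OF snoc.prems(1)[unfolded x] PQ(1) ins(1)]
  note box2 = rsk_last_box[OF snoc.prems(2)[unfolded w2 x] PQ(2) ins(2)]
  from snoc.prems(3) have eq: "P1' = P2'" "place a1 k1 Q1 = place a2 k2 Q2"
    by (auto simp: w2 x rsk_snoc PQ ins)
  from box1 box2 last_box_unique[of "place a1 k1 Q1" a1 k1 a2 k2] have
    ak: "a1 = a2" "k1 = k2" unfolding eq(2) by auto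
  from reverse_insertion_unique[of P1 P2 b1 P1' k1 b2] box1 box2 ins have
    bP: "b1 = b2" "P1 = P2" by (auto simp: eq ak)
  from place_inject[of Q1 Q2 a1 k1] box1 box2 have "Q1 = Q2" using eq(2) ak bP by auto
  with snoc.IH[of v2] snoc.prems(1,2) PQ bP w2 have "w1 = v2" by (auto simp: sorted_append)
  then show ?case using w2 x ak bP by simp
qed

text \<open>The word is built from its end, and the substance is that the result is sorted: the
  column split off must not precede the last column of the word obtained by induction.\<close>

lemma rsk_surj:
  assumes "semistandard P" "semistandard Q" "shape P = shape Q"
  shows "\<exists>w. sorted w \<and> rsk w = (P, Q)"
  using assms
proof (induction "size (entries Q)" arbitrary: P Q)
  case 0
  then have "entries Q = {#}" by simp
  then have "Q = []" using last_in_entries[OF 0(3), of 0] by auto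
  with 0 show ?case by (cases P) (auto intro!: exI[of _ "[]"])
next
  case (Suc n)
  then have "Q \<noteq> []" by auto
  with last_box_exists Suc.prems(2) obtain a k where box: "last_box Q a k" by blast
  from last_box_remove(1)[OF Suc.prems(2) box] obtain Q' where
    Q': "semistandard Q'" "k \<le> length Q'" "Q = place a k Q'" by blast
  have "length (P ! i) = length (Q ! i)" if "i < length Q" for i
    using Suc.prems(3) that by (metis length_shape nth_map shape_def)
  moreover have len: "length P = length Q" using Suc.prems(3) by (metis length_shape)
  ultimately obtain P' b where P': "semistandard P'" "tableau_insert b P' = (P, k)"
    using reverse_insertion_exists[OF Suc.prems(1), of k] last_box_remove(2)[OF Suc.prems(2) box] box
    by (auto simp: last_box_def)
  have "shape P' = shape Q'"
  proof (rule shape_place_inject)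
    show "shape (place b k P') = shape (place a k Q')"
      using shape_tableau_insert[OF P'(2) refl] Suc.prems(3) Q'(3) by simp
  qed (use semistandard_nonempty_rows P'(1) Q'(1,2) tableau_insert_index[OF P'(2)] in auto)
  moreover have "n = size (entries Q')" using Suc.hyps(2) Q'(3) by (simp add: entries_place)
  ultimately obtain w where w: "sorted w" "rsk w = (P', Q')"
    using Suc.hyps(1) P'(1) Q'(1) by blast
  have "rsk (w @ [(a, b)]) = (P, Q)" by (simp add: rsk_snoc w P'(2) Q'(3))
  moreover have "sorted (w @ [(a, b)])"
  proof (cases w rule: rev_cases)
    case Nil
    then show ?thesis by simp
  next
    case (snoc v x)
    obtain a' b' where x: "x = (a', b')" by fastforce
    obtain P0 Q0 where PQ0: "rsk v = (P0, Q0)" by fastforce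
    obtain P1 k' where P1: "tableau_insert b' P0 = (P1, k')" by fastforce
    have eq: "P' = P1" "Q' = place a' k' Q0"
      using w(2) by (auto simp: snoc x rsk_snoc PQ0 P1)
    from rsk_last_box[OF w(1)[unfolded snoc x] PQ0 P1] have box': "last_box Q' a' k'"
      unfolding eq by blast
    have "a' \<in># entries Q" unfolding Q'(3) eq by (simp add: entries_place)
    then have "a' \<le> a" using box by (simp add: last_box_def)
    moreover have "b' \<le> b" if "a' = a"
    proof (rule ccontr)
      \<comment> \<open>With equal upper letters and \<open>b < b'\<close> the last box would lie
        strictly below the previous one. Row \<open>k'\<close> is untouched by the last placement
        and already ends in \<open>a\<close>, so row \<open>k\<close> would not be the topmost such
        row.\<close>
      assume "\<not> b' \<le> b"
      with bumping_strict[OF P1 P'(2)[unfolded eq]] have "k' < k" by simp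
      moreover from this Q'(2) have "Q ! k' = Q' ! k'"
        unfolding Q'(3) by (auto simp: place_def nth_append)
      ultimately show False using box box' that by (auto simp: last_box_def)
    qed
    ultimately have "x \<le> (a, b)" by (cases "a' = a") (auto simp: x less_eq_prod_def)
    moreover have "y \<le> x" if "y \<in> set v" for y using that w(1) by (simp add: snoc sorted_append)
    ultimately show ?thesis using w(1) snoc by (auto simp: sorted_append intro: order.trans)
  qed
  ultimately show ?case by blast
qed

section \<open>Compatibility of RSK with relabelling of letters\<close>

lemma row_insert_map:
  assumes "strict_mono g"
  shows "row_insert (g x) (map g r) = map_prod (map g) (map_option g) (row_insert x r)"
  by (induction r) (auto simp: strict_mono_less[OF assms] split: prod.splits)

lemma tableau_insert_map:
  assumes "strict_mono g"
  shows "tableau_insert (g x) (map (map g) T) = map_prod (map (map g)) id (tableau_insert x T)"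
  by (induction T arbitrary: x)
    (auto simp: row_insert_map[OF assms] split: prod.splits option.splits)

text \<open>Lower letters are compared, so \<open>g\<close> has to preserve and reflect the order;
  upper letters are merely recorded, so \<open>f\<close> is arbitrary.\<close>

lemma rsk_map:
  assumes "strict_mono g"
  shows "rsk (map (map_prod f g) w) = map_prod (map (map g)) (map (map f)) (rsk w)"
proof (induction w rule: rev_induct)
  case (snoc x w)
  obtain a b where x: "x = (a, b)" by fastforce
  show ?case
    using snoc by (auto simp: x rsk_snoc tableau_insert_map[OF assms] place_def map_update
        split: prod.splits)
qed simp

section \<open>Matrices of partitions and tuples of biwords\<close>

definition profile :: "nat \<Rightarrow> nat list \<Rightarrow> nat \<Rightarrow> nat" where
  "profile a \<eta> = nth_default 0 (a # \<eta>)"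

lemma profile_0 [simp]: "profile a \<eta> 0 = a"
  by (simp add: profile_def)

lemma profile_eq_0: "length \<eta> < k \<Longrightarrow> profile a \<eta> k = 0"
  by (simp add: profile_def nth_default_def)

lemma antimono_profile:
  assumes "is_partition \<eta>" "\<forall>x\<in>set \<eta>. x \<le> a"
  shows "antimono (profile a \<eta>)"
proof (rule antimonoI)
  fix k m :: nat assume "k \<le> m"
  have "sorted_wrt (\<ge>) (a # \<eta>)" using assms by (simp add: is_partition_def)
  with \<open>k \<le> m\<close> show "profile a \<eta> m \<le> profile a \<eta> k"
    by (cases "k = m") (auto simp: profile_def nth_default_def sorted_wrt_iff_nth_less)
qed

text \<open>Parts are positive while the continuation is by zeros, so the sequence determines where
  the partition ends.\<close>

lemma profile_inject:
  assumes "is_partition \<eta>" "is_partition \<theta>" "profile a \<eta> = profile a \<theta>"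
  shows "\<eta> = \<theta>"
proof -
  have nth: "nth_default 0 \<eta> k = nth_default 0 \<theta> k" for k
    using fun_cong[OF assms(3), of "Suc k"] by (simp add: profile_def)
  have pos: "k < length \<eta> \<longleftrightarrow> 0 < nth_default 0 \<eta> k" "k < length \<theta> \<longleftrightarrow> 0 < nth_default 0 \<theta> k" for k
    using assms(1,2) by (auto simp: is_partition_def nth_default_def)
  then have "length \<eta> = length \<theta>" unfolding nth by (metis linorder_neqE_nat less_irrefl_nat)
  then show ?thesis using nth by (intro nth_equalityI) (metis nth_default_nth)+
qed

text \<open>Antimonotonicity makes the truncated subtractions exact, so the sum telescopes to
  \<open>f k - f l\<close>.\<close>

lemma sum_differences:
  fixes f :: "nat \<Rightarrow> nat"
  assumes "antimono f" "f l = 0" "k \<le> l"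
  shows "(\<Sum>t\<in>{k<..l}. f (t - 1) - f t) = f k"
proof -
  have "(\<Sum>t\<in>{k<..m}. f (t - 1) - f t) = f k - f m" if "k \<le> m" for m
    using that
  proof (induction m rule: dec_induct)
    case (step m)
    have "{k<..Suc m} = insert (Suc m) {k<..m}" using step.hyps by auto
    with step antimonoD[OF assms(1), of k m] antimonoD[OF assms(1), of m "Suc m"] show ?case
      by simp
  qed simp
  with assms show ?thesis by simp
qed

text \<open>Inverse of taking consecutive differences: if \<open>c t\<close> is the multiplicity of
  a biletter in the biword number \<open>t\<close>, then index \<open>k\<close> gives back \<eta>_k,
  and \<open>k = 0\<close> gives back the matrix entry.\<close>

definition tail_sum :: "nat \<Rightarrow> (nat \<Rightarrow> nat) \<Rightarrow> nat \<Rightarrow> nat" where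
  "tail_sum l c k = (\<Sum>t\<in>{k<..l}. c t)"

text \<open>\<open>takeWhile\<close> removes the trailing zeros, as a partition has positive parts
  only. Indices from \<open>l\<close> on are left out because their tail sums are empty.\<close>

definition tail_partition :: "nat \<Rightarrow> (nat \<Rightarrow> nat) \<Rightarrow> nat list" where
  "tail_partition l c = takeWhile (\<lambda>x. 0 < x) (map (tail_sum l c) [1..<l])"

lemma antimono_tail_sum: "k \<le> m \<Longrightarrow> tail_sum l c m \<le> tail_sum l c k"
  unfolding tail_sum_def by (intro sum_mono2) auto

lemma tail_sum_eq_0: "(\<And>t. k < t \<Longrightarrow> t \<le> l \<Longrightarrow> c t = 0) \<Longrightarrow> tail_sum l c k = 0"
  by (simp add: tail_sum_def)

lemma tail_sum_diff:
  assumes "1 \<le> t" "t \<le> l"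
  shows "tail_sum l c (t - 1) - tail_sum l c t = c t"
proof -
  have "{t - 1<..l} = insert t {t<..l}" using assms by auto
  then show ?thesis by (simp add: tail_sum_def)
qed

lemma nth_tail_partition:
  assumes "k < length (tail_partition l c)"
  shows "tail_partition l c ! k = tail_sum l c (Suc k)" "0 < tail_sum l c (Suc k)"
proof -
  let ?xs = "map (tail_sum l c) [1..<l]"
  have "k < l - 1" using assms length_takeWhile_le[of "\<lambda>x. 0 < x" ?xs]
    unfolding tail_partition_def by simp
  then show eq: "tail_partition l c ! k = tail_sum l c (Suc k)"
    using takeWhile_nth[OF assms[unfolded tail_partition_def]] by (simp add: tail_partition_def)
  show "0 < tail_sum l c (Suc k)"
    using nth_mem[OF assms] unfolding eq by (auto simp: tail_partition_def dest: set_takeWhileD)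
qed

lemma is_partition_tail_partition: "is_partition (tail_partition l c)"
  unfolding is_partition_def sorted_wrt_iff_nth_less
  by (auto simp: nth_tail_partition in_set_conv_nth intro!: antimono_tail_sum)

text \<open>The list stops either at a vanishing tail sum or just before index \<open>l\<close>,
  where the tail sum is empty. Tail sums decrease, so all omitted ones are zero, in agreement with
  the default value.\<close>

lemma profile_tail: "profile (tail_sum l c 0) (tail_partition l c) k = tail_sum l c k"
proof (cases k)
  case (Suc m)
  show ?thesis
  proof (cases "m < length (tail_partition l c)")
    case True
    with Suc show ?thesis by (simp add: profile_def nth_default_def nth_tail_partition)
  next
    case False
    let ?xs = "map (tail_sum l c) [1..<l]" and ?n = "length (tail_partition l c)"
    have "tail_sum l c (Suc ?n) = 0"
    proof (cases "?n < l - 1")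
      case True
      with nth_length_takeWhile[of "\<lambda>x. 0 < x" ?xs] show ?thesis
        by (simp add: tail_partition_def)
    next
      case False
      then show ?thesis by (intro tail_sum_eq_0) auto
    qed
    with antimono_tail_sum[of "Suc ?n" k l c] False Suc have "tail_sum l c k = 0" by simp
    with False Suc show ?thesis by (simp add: profile_def nth_default_def)
  qed
qed simp

text \<open>Meant for \<open>m = min p q\<close>: a biletter occurring only in the biwords up to
  number \<open>m\<close> has tail sum zero at index \<open>m\<close>, so at most
  \<open>m - 1\<close> parts are positive.\<close>

lemma length_tail_partition:
  assumes "\<And>t. m < t \<Longrightarrow> t \<le> l \<Longrightarrow> c t = 0" "1 \<le> m"
  shows "length (tail_partition l c) \<le> m - 1"
proof (rule ccontr)
  assume "\<not> length (tail_partition l c) \<le> m - 1"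
  with nth_tail_partition(2)[of "m - 1" l c] assms(2) have "0 < tail_sum l c m" by simp
  with tail_sum_eq_0[of m l c] assms(1) show False by simp
qed

section \<open>Multiplicities in the biwords attached to a pair\<close>

definition Psi_multiplicity :: "nat \<Rightarrow> parmat \<Rightarrow> nat \<Rightarrow> letter \<times> letter \<Rightarrow> nat" where
  "Psi_multiplicity l = (\<lambda>(A, P) t ((p, i), (q, j)).
     if (p, q) \<in> blocks l \<and> 1 \<le> i \<and> 1 \<le> j
     then profile (A (p, q) i j) (P (p, q) i j) (t - 1) - profile (A (p, q) i j) (P (p, q) i j) t
     else 0)"

lemma Psi_biword_eq: "Psi_biword l X t = biword_of (Psi_multiplicity l X t)"
  unfolding Psi_biword_def Psi_multiplicity_def profile_def Let_def by (cases X) simp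

lemma nat_matricesD:
  assumes "M \<in> nat_matrices"
  shows "finite {(i, j). M i j \<noteq> 0}" "M i 0 = 0" "M 0 j = 0"
  using assms by (auto simp: nat_matrices_def)

lemma partition_matricesD:
  assumes "M \<in> partition_matrices"
  shows "is_partition (M i j)" "finite {(i, j). M i j \<noteq> []}" "M i 0 = []" "M 0 j = []"
  using assms by (auto simp: partition_matrices_def)

lemma ParMatD:
  assumes "(A, P) \<in> ParMat l \<nu> \<mu>"
  shows "A \<in> blocks l \<rightarrow>\<^sub>E nat_matrices" "P \<in> blocks l \<rightarrow>\<^sub>E partition_matrices"
    "\<And>s t. s \<in> {1..l} \<Longrightarrow> 1 \<le> t \<Longrightarrow> (\<Sum>q=1..l. \<Sum>j. A (s, q) t j) = part (component \<nu> s) t"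
    "\<And>s t. s \<in> {1..l} \<Longrightarrow> 1 \<le> t \<Longrightarrow> (\<Sum>p=1..l. \<Sum>i. A (p, s) i t) = part (component \<mu> s) t"
    "\<And>p q i j x. (p, q) \<in> blocks l \<Longrightarrow> 1 \<le> i \<Longrightarrow> 1 \<le> j \<Longrightarrow> x \<in> set (P (p, q) i j) \<Longrightarrow>
      x \<le> A (p, q) i j"
    "\<And>p q i j. (p, q) \<in> blocks l \<Longrightarrow> 1 \<le> i \<Longrightarrow> 1 \<le> j \<Longrightarrow>
      length (P (p, q) i j) \<le> min p q - 1"
  using assms by (auto simp: ParMat_def)

lemma ParMat_profile:
  assumes "(A, P) \<in> ParMat l \<nu> \<mu>" "(p, q) \<in> blocks l" "1 \<le> i" "1 \<le> j"
  shows "antimono (profile (A (p, q) i j) (P (p, q) i j))"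
    "min p q \<le> k \<Longrightarrow> profile (A (p, q) i j) (P (p, q) i j) k = 0"
proof -
  have "P (p, q) \<in> partition_matrices" using ParMatD(2)[OF assms(1)] assms(2) by auto
  then show "antimono (profile (A (p, q) i j) (P (p, q) i j))"
    using partition_matricesD(1) ParMatD(5)[OF assms] by (intro antimono_profile) auto
  show "profile (A (p, q) i j) (P (p, q) i j) k = 0" if "min p q \<le> k"
    using that ParMatD(6)[OF assms] assms(2) by (intro profile_eq_0) (auto simp: min_def split: if_splits)
qed

text \<open>A difference is at most its first term, hence at most the value at index 0, which is the
  matrix entry. So the support is bounded by that of the finitely many blocks of
  \<open>A\<close>.\<close>

lemma finite_Psi_multiplicity:
  assumes "(A, P) \<in> ParMat l \<nu> \<mu>"
  shows "finite {x. 0 < Psi_multiplicity l (A, P) t x}"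
proof (rule finite_subset)
  let ?S = "\<Union>(p, q)\<in>blocks l. (\<lambda>(i, j). ((p, i), (q, j))) ` {(i, j). A (p, q) i j \<noteq> 0}"
  show "finite ?S"
  proof (intro finite_UN_I)
    fix pq assume "pq \<in> blocks l"
    with ParMatD(1)[OF assms] have "A pq \<in> nat_matrices" by blast
    from nat_matricesD(1)[OF this] show "finite (case pq of (p, q) \<Rightarrow>
        (\<lambda>(i, j). ((p, i), (q, j))) ` {(i, j). A (p, q) i j \<noteq> 0})"
      by (cases pq) auto
  qed auto
  show "{x. 0 < Psi_multiplicity l (A, P) t x} \<subseteq> ?S"
  proof clarify
    fix p i q j assume *: "0 < Psi_multiplicity l (A, P) t ((p, i), (q, j))"
    then have cell: "(p, q) \<in> blocks l" "1 \<le> i" "1 \<le> j"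
      by (auto simp: Psi_multiplicity_def split: if_splits)
    with * have "0 < profile (A (p, q) i j) (P (p, q) i j) (t - 1)"
      by (simp add: Psi_multiplicity_def)
    also have "\<dots> \<le> A (p, q) i j"
      using antimonoD[OF ParMat_profile(1)[OF assms cell], of 0 "t - 1"] by simp
    finally show "((p, i), (q, j)) \<in> ?S" using cell(1) by force
  qed
qed

lemma
  assumes "X \<in> ParMat l \<nu> \<mu>"
  shows sorted_Psi_biword: "sorted (Psi_biword l X t)"
    and count_Psi_biword: "count (mset (Psi_biword l X t)) = Psi_multiplicity l X t"
proof -
  from assms have "finite {x. 0 < Psi_multiplicity l X t x}"
    by (cases X) (auto intro: finite_Psi_multiplicity)
  from biword_of_unique[OF this, of "Psi_biword l X t"]
  show "sorted (Psi_biword l X t)"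
    "count (mset (Psi_biword l X t)) = Psi_multiplicity l X t"
    by (auto simp: Psi_biword_eq biword_iff_sorted)
qed

text \<open>Inside the blocks \<open>min p q \<le> l\<close>, so the profile has reached zero at
  \<open>l\<close> and the differences up to \<open>l\<close> recover it completely. At
  \<open>k = 0\<close> this says that the biwords together contain each biletter as often as the
  matrix entry prescribes.\<close>

lemma tail_sum_Psi_multiplicity:
  assumes "(A, P) \<in> ParMat l \<nu> \<mu>" "(p, q) \<in> blocks l" "1 \<le> i" "1 \<le> j" "k \<le> l"
  shows "tail_sum l (\<lambda>t. Psi_multiplicity l (A, P) t ((p, i), (q, j))) k =
    profile (A (p, q) i j) (P (p, q) i j) k"
proof -
  have "profile (A (p, q) i j) (P (p, q) i j) l = 0"
    using assms(2) by (intro ParMat_profile(2)[OF assms(1-4)]) auto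
  from sum_differences[OF ParMat_profile(1)[OF assms(1-4)] this assms(5)] show ?thesis
    using assms(2-4) by (simp add: tail_sum_def Psi_multiplicity_def)
qed

text \<open>A positive difference at \<open>t\<close> requires a positive value at
  \<open>t - 1\<close>, and the profile vanishes from index \<open>min p q\<close> on; thus
  \<open>t \<le> min p q\<close>. This is the subscript condition on multitableaux.\<close>

lemma Psi_multiplicity_support:
  assumes "(A, P) \<in> ParMat l \<nu> \<mu>" "0 < Psi_multiplicity l (A, P) t ((p, i), (q, j))"
  shows "(p, q) \<in> blocks l" "1 \<le> i" "1 \<le> j" "t \<le> p" "t \<le> q"
proof -
  from assms(2) show cell: "(p, q) \<in> blocks l" "1 \<le> i" "1 \<le> j"
    by (auto simp: Psi_multiplicity_def split: if_splits)
  with assms(2) have "0 < profile (A (p, q) i j) (P (p, q) i j) (t - 1)"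
    by (simp add: Psi_multiplicity_def)
  with ParMat_profile(2)[OF assms(1) cell, of "t - 1"] have "t - 1 < min p q"
    by (metis not_less less_irrefl)
  then show "t \<le> p" "t \<le> q" using cell(1) by auto
qed

section \<open>Contents of biwords as row and column sums\<close>

lemma finite_count_vimage: "inj f \<Longrightarrow> finite {j. count M (f j) \<noteq> 0}"
  using finite_vimageI[of "set_mset M" f] by (simp add: vimage_def)

text \<open>Forgetting the lower letters turns multiplicities into row sums. The sum over
  \<open>j\<close> is a \<open>Sum_any\<close>, which is additive only under finite support; adding
  one element at a time supplies this through \<open>fin\<close>.\<close>

lemma count_image_fst:
  fixes M :: "('a \<times> letter) multiset"
  assumes "\<And>x q j. (x, (q, j)) \<in># M \<Longrightarrow> q \<in> {1..l}"
  shows "count (image_mset fst M) x = (\<Sum>q=1..l. \<Sum>j. count M (x, (q, j)))"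
  using assms
proof (induction M)
  case (add y M)
  obtain x' q' j' where y: "y = (x', (q', j'))" by (metis prod.collapse)
  have q': "q' \<in> {1..l}" using add.prems[of x' q' j'] by (simp add: y)
  have fin: "finite {j. count M (x, (q, j)) \<noteq> 0}" for q
    by (rule finite_count_vimage) (auto intro: injI)
  have "(\<Sum>j. count (add_mset y M) (x, (q, j))) =
      (\<Sum>j. count M (x, (q, j)) + (if j = j' then if x = x' \<and> q = q' then 1 else 0 else 0))" for q
    by (intro Sum_any.cong) (auto simp: y)
  also have "\<dots> q = (\<Sum>j. count M (x, (q, j))) + (if x = x' \<and> q = q' then 1 else 0)" for q
    by (subst Sum_any.distrib[OF fin]) auto
  finally have step: "(\<Sum>q=1..l. \<Sum>j. count (add_mset y M) (x, (q, j))) =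
      (\<Sum>q=1..l. \<Sum>j. count M (x, (q, j))) + (\<Sum>q=1..l. if x = x' \<and> q = q' then 1 else 0)"
    by (simp add: sum.distrib)
  have "(\<Sum>q=1..l. if x = x' \<and> q = q' then 1 else 0) = (if x = x' then 1 else 0 :: nat)"
    using q' by (cases "x = x'") auto
  moreover have "count (image_mset fst M) x = (\<Sum>q=1..l. \<Sum>j. count M (x, (q, j)))"
    using add.prems by (intro add.IH) auto
  moreover have "count (image_mset fst (add_mset y M)) x =
      count (image_mset fst M) x + (if x = x' then 1 else 0)" by (simp add: y)
  ultimately show ?case unfolding step by (simp only:)
qed simp

lemma count_image_snd:
  fixes M :: "(letter \<times> 'a) multiset"
  assumes "\<And>x p i. ((p, i), x) \<in># M \<Longrightarrow> p \<in> {1..l}"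
  shows "count (image_mset snd M) x = (\<Sum>p=1..l. \<Sum>i. count M ((p, i), x))"
proof -
  have swap: "count (image_mset prod.swap M) (x, y) = count M (y, x)" for x y
    by (induction M) auto
  have "image_mset snd M = image_mset fst (image_mset prod.swap M)"
    by (simp add: multiset.map_comp comp_def)
  with count_image_fst[of "image_mset prod.swap M" l x] assms show ?thesis
    by (auto simp: swap)
qed

lemma eq_alphabetI:
  assumes "length \<nu> = l" "\<And>p i. (p, i) \<in># M \<Longrightarrow> p \<in> {1..l} \<and> 1 \<le> i"
    "\<And>s t. s \<in> {1..l} \<Longrightarrow> 1 \<le> t \<Longrightarrow> count M (s, t) = part (component \<nu> s) t"
  shows "M = alphabet \<nu>"
proof (rule multiset_eqI)
  fix x :: letter
  obtain s t where x: "x = (s, t)" by fastforce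
  show "count M x = count (alphabet \<nu>) x"
  proof (cases "s \<in> {1..l} \<and> 1 \<le> t")
    case True
    then show ?thesis using assms(1,3) by (simp add: x count_alphabet)
  next
    case False
    then have "x \<notin># M" using assms(2) x by blast
    then show ?thesis using False assms(1) by (auto simp: x count_alphabet not_in_iff)
  qed
qed

lemma in_alphabetD:
  assumes "(p, i) \<in># alphabet \<nu>"
  shows "p \<in> {1..length \<nu>}" "1 \<le> i"
  using assms by (auto simp: count_alphabet count_greater_zero_iff[symmetric]
      simp del: count_greater_zero_iff split: if_splits)

text \<open>Mirrors the conditions on both multitableaux at once: the bound
  \<open>t \<le> p \<and> t \<le> q\<close> is the subscript condition for the recording and
  insertion side, and the contents are prescribed for the whole tuple, not for each
  component.\<close>

definition biword_tuples ::
  "nat \<Rightarrow> nat list list \<Rightarrow> nat list list \<Rightarrow> (letter \<times> letter) list list set" where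
  "biword_tuples l \<nu> \<mu> = {ws. length ws = l \<and>
     (\<forall>t\<in>{1..l}. sorted (component ws t) \<and>
        (\<forall>((p, i), (q, j))\<in>set (component ws t). t \<le> p \<and> t \<le> q)) \<and>
     (\<Sum>t=1..l. mset (map fst (component ws t))) = alphabet \<nu> \<and>
     (\<Sum>t=1..l. mset (map snd (component ws t))) = alphabet \<mu>}"

lemma in_sum_mset_iff: "finite A \<Longrightarrow> x \<in># sum M A \<longleftrightarrow> (\<exists>t\<in>A. x \<in># M t)"
  by (induction A rule: finite_induct) auto

lemma image_mset_sum: "image_mset f (sum M A) = (\<Sum>t\<in>A. image_mset f (M t))"
  by (induction A rule: infinite_finite_induct) auto

lemma count_sum_mset: "count (\<Sum>t=1..l. M t) x = tail_sum l (\<lambda>t. count (M t) x) 0"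
proof -
  have "{1..l} = {0<..l}" by auto
  then show ?thesis by (simp add: tail_sum_def count_sum)
qed

lemma Psi_biwords_in_tuples:
  assumes X: "X \<in> ParMat l \<nu> \<mu>" and "length \<nu> = l" "length \<mu> = l"
  shows "map (Psi_biword l X) [1..<Suc l] \<in> biword_tuples l \<nu> \<mu>"
proof -
  obtain A P where AP: "X = (A, P)" by fastforce
  note X' = X[unfolded AP]
  have comp: "component (map (Psi_biword l X) [1..<Suc l]) t = Psi_biword l X t"
    if "t \<in> {1..l}" for t using that by (cases t) (auto simp del: upt_Suc)
  \<comment> \<open>All biwords are pooled, since contents are only prescribed in total. By
    telescoping the pooled multiplicities are the entries of \<open>A\<close>, without any trace of
    \<open>P\<close>.\<close>
  define M where "M = (\<Sum>t=1..l. mset (Psi_biword l X t))"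
  have count: "count M ((p, i), (q, j)) =
      (if (p, q) \<in> blocks l \<and> 1 \<le> i \<and> 1 \<le> j then A (p, q) i j else 0)" for p i q j
  proof (cases "(p, q) \<in> blocks l \<and> 1 \<le> i \<and> 1 \<le> j")
    case True
    with tail_sum_Psi_multiplicity[OF X', of p q i j 0] show ?thesis
      unfolding M_def count_sum_mset AP count_Psi_biword[OF X'] by simp
  next
    case False
    then have "Psi_multiplicity l X t ((p, i), (q, j)) = 0" for t
      by (auto simp: AP Psi_multiplicity_def)
    with False show ?thesis
      unfolding M_def count_sum_mset count_Psi_biword[OF X] by (auto simp: tail_sum_def)
  qed
  have support: "(p, q) \<in> blocks l \<and> 1 \<le> i \<and> 1 \<le> j" if "((p, i), (q, j)) \<in># M" for p i q j
    using that count[of p i q j] by (metis not_in_iff)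
  have A0: "A (p, q) 0 k = 0" "A (p, q) k 0 = 0" if "p \<in> {1..l}" "q \<in> {1..l}" for p q k
  proof -
    have "A (p, q) \<in> nat_matrices" using that ParMatD(1)[OF X'] by blast
    then show "A (p, q) 0 k = 0" "A (p, q) k 0 = 0" by (rule nat_matricesD)+
  qed
  have "image_mset fst M = alphabet \<nu>"
  proof (rule eq_alphabetI[OF assms(2)])
    show "p \<in> {1..l} \<and> 1 \<le> i" if "(p, i) \<in># image_mset fst M" for p i
      using that support by fastforce
    fix s t assume st: "s \<in> {1..l}" "1 \<le> (t :: nat)"
    have "count (image_mset fst M) (s, t) = (\<Sum>q=1..l. \<Sum>j. count M ((s, t), (q, j)))"
      by (rule count_image_fst) (use support in auto)
    also have "\<dots> = (\<Sum>q=1..l. \<Sum>j. A (s, q) t j)"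
      using st A0 by (intro sum.cong Sum_any.cong refl) (auto simp: count Suc_le_eq)
    finally show "count (image_mset fst M) (s, t) = part (component \<nu> s) t"
      using ParMatD(3)[OF X' st] by simp
  qed
  moreover have "image_mset snd M = alphabet \<mu>"
  proof (rule eq_alphabetI[OF assms(3)])
    show "p \<in> {1..l} \<and> 1 \<le> i" if "(p, i) \<in># image_mset snd M" for p i
      using that support by fastforce
    fix s t assume st: "s \<in> {1..l}" "1 \<le> (t :: nat)"
    have "count (image_mset snd M) (s, t) = (\<Sum>p=1..l. \<Sum>i. count M ((p, i), (s, t)))"
      by (rule count_image_snd) (use support in auto)
    also have "\<dots> = (\<Sum>p=1..l. \<Sum>i. A (p, s) i t)"
      using st A0 by (intro sum.cong Sum_any.cong refl) (auto simp: count Suc_le_eq)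
    finally show "count (image_mset snd M) (s, t) = part (component \<mu> s) t"
      using ParMatD(4)[OF X' st] by simp
  qed
  moreover have "t \<le> p \<and> t \<le> q" if "((p, i), (q, j)) \<in> set (Psi_biword l X t)" for p i q j t
  proof -
    have "0 < Psi_multiplicity l X t ((p, i), (q, j))"
      using that by (metis count_Psi_biword[OF X] count_greater_zero_iff set_mset_mset)
    with Psi_multiplicity_support(4,5)[OF X'] AP show ?thesis by blast
  qed
  moreover have "(\<Sum>t=1..l. mset (map f (component (map (Psi_biword l X) [1..<Suc l]) t))) =
      image_mset f M" for f :: "_ \<Rightarrow> letter"
    unfolding M_def image_mset_sum by (intro sum.cong refl) (simp only: comp mset_map)
  ultimately show ?thesis
    unfolding biword_tuples_def mem_Collect_eq
    using sorted_Psi_biword[OF X] comp by auto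
qed

text \<open>Multiplicities are known only for \<open>t\<close> up to \<open>l\<close>; tail sums
  recover the profiles up to index \<open>l\<close>, and beyond it all profiles are zero. Index 0
  and pairs outside the blocks are fixed by convention.\<close>

lemma inj_on_Psi_biwords: "inj_on (\<lambda>X. map (Psi_biword l X) [1..<Suc l]) (ParMat l \<nu> \<mu>)"
proof (rule inj_onI)
  fix X Y assume X: "X \<in> ParMat l \<nu> \<mu>" and Y: "Y \<in> ParMat l \<nu> \<mu>"
    and eq: "map (Psi_biword l X) [1..<Suc l] = map (Psi_biword l Y) [1..<Suc l]"
  obtain A P B Q where AP: "X = (A, P)" "Y = (B, Q)" by fastforce
  note X' = X[unfolded AP] and Y' = Y[unfolded AP]
  have mult: "Psi_multiplicity l X t = Psi_multiplicity l Y t" if "t \<in> {1..l}" for t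
  proof -
    have "Psi_biword l X t = Psi_biword l Y t" using eq that by (simp del: upt_Suc)
    then show ?thesis by (metis X Y count_Psi_biword)
  qed
  have cell: "A (p, q) i j = B (p, q) i j \<and> P (p, q) i j = Q (p, q) i j"
    if pq: "(p, q) \<in> blocks l" for p q i j
  proof -
    from pq have mem: "A (p, q) \<in> nat_matrices" "B (p, q) \<in> nat_matrices"
      "P (p, q) \<in> partition_matrices" "Q (p, q) \<in> partition_matrices"
      using ParMatD(1,2)[OF X'] ParMatD(1,2)[OF Y'] by auto
    show ?thesis
    proof (cases "1 \<le> i \<and> 1 \<le> j")
      case True
      then have ij: "1 \<le> i" "1 \<le> j" by auto
      have "profile (A (p, q) i j) (P (p, q) i j) k = profile (B (p, q) i j) (Q (p, q) i j) k" for k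
      proof (cases "k \<le> l")
        case True
        have "tail_sum l (\<lambda>t. Psi_multiplicity l X t x) k =
            tail_sum l (\<lambda>t. Psi_multiplicity l Y t x) k" for x
          unfolding tail_sum_def by (intro sum.cong) (auto simp: mult)
        with tail_sum_Psi_multiplicity[OF X' pq ij True] tail_sum_Psi_multiplicity[OF Y' pq ij True]
        show ?thesis by (simp add: AP)
      next
        case False
        then have "min p q \<le> k" using pq by auto
        then show ?thesis using ParMat_profile(2)[OF X' pq ij] ParMat_profile(2)[OF Y' pq ij] by simp
      qed
      then have prof: "profile (A (p, q) i j) (P (p, q) i j) = profile (B (p, q) i j) (Q (p, q) i j)"
        by blast
      from fun_cong[OF this, of 0] have "A (p, q) i j = B (p, q) i j" by simp
      with prof mem show ?thesis by (auto intro!: profile_inject dest: partition_matricesD(1))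
    next
      case False
      then have "i = 0 \<or> j = 0" by auto
      with mem show ?thesis by (auto simp: nat_matricesD partition_matricesD)
    qed
  qed
  have "A = B"
    using ParMatD(1)[OF X'] ParMatD(1)[OF Y'] by (rule PiE_ext) (use cell in \<open>auto intro!: ext\<close>)
  moreover have "P = Q"
    using ParMatD(2)[OF X'] ParMatD(2)[OF Y'] by (rule PiE_ext) (use cell in \<open>auto intro!: ext\<close>)
  ultimately show "X = Y" by (simp add: AP)
qed

lemma Psi_biwords_surj:
  assumes ws: "ws \<in> biword_tuples l \<nu> \<mu>" and "length \<nu> = l" "length \<mu> = l"
  shows "\<exists>X\<in>ParMat l \<nu> \<mu>. map (Psi_biword l X) [1..<Suc l] = ws"
proof -
  have len: "length ws = l"
    and sorted: "\<And>t. t \<in> {1..l} \<Longrightarrow> sorted (component ws t)"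
    and support: "\<And>t p i q j. t \<in> {1..l} \<Longrightarrow> ((p, i), (q, j)) \<in> set (component ws t) \<Longrightarrow>
      t \<le> p \<and> t \<le> q"
    and content: "(\<Sum>t=1..l. mset (map fst (component ws t))) = alphabet \<nu>"
      "(\<Sum>t=1..l. mset (map snd (component ws t))) = alphabet \<mu>"
    using ws by (fastforce simp: biword_tuples_def)+
  define M where "M = (\<Sum>t=1..l. mset (component ws t))"
  have image: "image_mset fst M = alphabet \<nu>" "image_mset snd M = alphabet \<mu>"
    using content by (simp_all add: M_def image_mset_sum)
  \<comment> \<open>The prescribed contents confine every biletter to the blocks, since the
    alphabets contain only subscripts from 1 to \<open>l\<close> and indices from 1 on.\<close>
  have M: "(p, q) \<in> blocks l \<and> 1 \<le> i \<and> 1 \<le> j" if "((p, i), (q, j)) \<in># M" for p i q j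
  proof -
    have "(p, i) \<in># alphabet \<nu>" "(q, j) \<in># alphabet \<mu>"
      using that image by (metis fst_conv snd_conv imageI set_image_mset)+
    with in_alphabetD[of p i \<nu>] in_alphabetD[of q j \<mu>] assms(2,3) show ?thesis by auto
  qed
  define c where "c p q i j t = count (mset (component ws t)) ((p, i), (q, j))" for p q i j t
  have c_support: "t \<le> min p q" "(p, q) \<in> blocks l" "1 \<le> i" "1 \<le> j"
    if "t \<in> {1..l}" "0 < c p q i j t" for p q i j t
  proof -
    have *: "((p, i), (q, j)) \<in># mset (component ws t)"
      using that(2) by (simp add: c_def)
    then have "((p, i), (q, j)) \<in> set (component ws t)" by (simp only: set_mset_mset)
    from support[OF that(1) this] show "t \<le> min p q" by simp
    have "((p, i), (q, j)) \<in># M"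
      unfolding M_def in_sum_mset_iff[OF finite_atLeastAtMost] using that(1) * by (rule bexI[rotated])
    from M[OF this] show "(p, q) \<in> blocks l" "1 \<le> i" "1 \<le> j" by blast+
  qed
  have count_M: "count M ((p, i), (q, j)) = tail_sum l (c p q i j) 0" for p q i j
    unfolding M_def count_sum_mset c_def ..
  define A where "A = (\<lambda>(p, q)\<in>blocks l. \<lambda>i j. tail_sum l (c p q i j) 0)"
  define P where "P = (\<lambda>(p, q)\<in>blocks l. \<lambda>i j. tail_partition l (c p q i j))"
  have A: "A (p, q) i j = count M ((p, i), (q, j))" if "(p, q) \<in> blocks l" for p q i j
    using that unfolding count_M by (simp add: A_def)
  have P: "P (p, q) i j = tail_partition l (c p q i j)" if "(p, q) \<in> blocks l" for p q i j
    using that by (simp add: P_def)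
  \<comment> \<open>The first part is a tail sum contained in the one at index 0, the matrix entry.
    Hence \<open>P\<close> inherits finite support and trivial row and column 0 from
    \<open>A\<close>.\<close>
  have P_Nil: "P (p, q) i j = []" if "(p, q) \<in> blocks l" "A (p, q) i j = 0" for p q i j
  proof (rule ccontr)
    assume "P (p, q) i j \<noteq> []"
    with nth_tail_partition(2)[of 0 l "c p q i j"] antimono_tail_sum[of 0 1 l "c p q i j"]
      that P[OF that(1)] A[OF that(1)]
    show False by (simp add: count_M)
  qed
  have finite_A: "finite {(i, j). A (p, q) i j \<noteq> 0}" if "(p, q) \<in> blocks l" for p q
  proof -
    have "inj (\<lambda>(i, j). ((p, i), (q, j)))" by (auto intro: injI)
    moreover have "{(i, j). A (p, q) i j \<noteq> 0} = {x. count M (case x of (i, j) \<Rightarrow> ((p, i), (q, j))) \<noteq> 0}"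
      using A[OF that] by auto
    ultimately show ?thesis using finite_count_vimage by simp
  qed
  have A0: "A (p, q) i j = 0" if "(p, q) \<in> blocks l" "i = 0 \<or> j = 0" for p q i j
  proof -
    have "((p, i), (q, j)) \<notin># M" using that(2) M[of p i q j] by auto
    then show ?thesis by (simp add: A[OF that(1)] not_in_iff)
  qed
  have "A \<in> blocks l \<rightarrow>\<^sub>E nat_matrices"
  proof (intro PiE_I)
    fix pq assume "pq \<in> blocks l"
    then obtain p q where pq: "pq = (p, q)" "(p, q) \<in> blocks l" by (cases pq) auto
    show "A pq \<in> nat_matrices"
      using finite_A[OF pq(2)] A0[OF pq(2)] unfolding pq(1) nat_matrices_def by blast
  next
    fix pq assume "pq \<notin> blocks l"
    then show "A pq = undefined" unfolding A_def by (simp only: restrict_apply if_False)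
  qed
  moreover have "P \<in> blocks l \<rightarrow>\<^sub>E partition_matrices"
  proof (intro PiE_I)
    fix pq assume "pq \<in> blocks l"
    then obtain p q where pq: "pq = (p, q)" "(p, q) \<in> blocks l" by (cases pq) auto
    have "finite {(i, j). P (p, q) i j \<noteq> []}"
      by (rule finite_subset[OF _ finite_A[OF pq(2)]]) (use P_Nil[OF pq(2)] in auto)
    moreover have "is_partition (P (p, q) i j)" for i j
      by (simp add: P[OF pq(2)] is_partition_tail_partition)
    ultimately show "P pq \<in> partition_matrices"
      using A0[OF pq(2)] P_Nil[OF pq(2)] unfolding pq(1) partition_matrices_def by blast
  next
    fix pq assume "pq \<notin> blocks l"
    then show "P pq = undefined" unfolding P_def by (simp only: restrict_apply if_False)
  qed
  moreover have "(\<Sum>q=1..l. \<Sum>j. A (s, q) t j) = part (component \<nu> s) t"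
    if "s \<in> {1..l}" "1 \<le> t" for s t
  proof -
    have "(\<Sum>q=1..l. \<Sum>j. A (s, q) t j) = (\<Sum>q=1..l. \<Sum>j. count M ((s, t), (q, j)))"
      using that(1) by (intro sum.cong Sum_any.cong refl) (simp add: A)
    also have "\<dots> = count (image_mset fst M) (s, t)"
      by (rule count_image_fst[symmetric]) (use M in auto)
    finally show ?thesis using that assms(2) by (simp add: image count_alphabet)
  qed
  moreover have "(\<Sum>p=1..l. \<Sum>i. A (p, s) i t) = part (component \<mu> s) t"
    if "s \<in> {1..l}" "1 \<le> t" for s t
  proof -
    have "(\<Sum>p=1..l. \<Sum>i. A (p, s) i t) = (\<Sum>p=1..l. \<Sum>i. count M ((p, i), (s, t)))"
      using that(1) by (intro sum.cong Sum_any.cong refl) (simp add: A)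
    also have "\<dots> = count (image_mset snd M) (s, t)"
      by (rule count_image_snd[symmetric]) (use M in auto)
    finally show ?thesis using that assms(3) by (simp add: image count_alphabet)
  qed
  moreover have "x \<le> A (p, q) i j" if "(p, q) \<in> blocks l" "x \<in> set (P (p, q) i j)" for p q i j x
    using that by (auto simp: A P count_M in_set_conv_nth nth_tail_partition antimono_tail_sum)
  moreover have "length (P (p, q) i j) \<le> min p q - 1" if "(p, q) \<in> blocks l" for p q i j
    unfolding P[OF that]
  proof (rule length_tail_partition)
    show "c p q i j t = 0" if "min p q < t" "t \<le> l" for t
      using c_support(1)[of t p q i j] that by fastforce
  qed (use that in auto)
  ultimately have X: "(A, P) \<in> ParMat l \<nu> \<mu>" by (auto simp: ParMat_def)
  have "Psi_biword l (A, P) t = component ws t" if t: "t \<in> {1..l}" for t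
  proof -
    have "Psi_multiplicity l (A, P) t ((p, i), (q, j)) =
        count (mset (component ws t)) ((p, i), (q, j))" for p i q j
    proof (cases "(p, q) \<in> blocks l \<and> 1 \<le> i \<and> 1 \<le> j")
      case True
      then show ?thesis
        using t tail_sum_diff[of t l "c p q i j"]
        by (simp add: Psi_multiplicity_def A P count_M profile_tail c_def)
    next
      case False
      then have "c p q i j t = 0" using c_support[OF t, of p q i j] by fastforce
      with False show ?thesis by (auto simp: Psi_multiplicity_def c_def)
    qed
    then have "Psi_multiplicity l (A, P) t = count (mset (component ws t))" by auto
    then show ?thesis
      using biword_of_unique[of "count (mset (component ws t))" "component ws t"] sorted[OF t]
      by (simp add: Psi_biword_eq biword_iff_sorted)
  qed
  then have "map (Psi_biword l (A, P)) [1..<Suc l] = ws"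
    using len by (intro nth_equalityI) (auto simp: nth_append simp del: upt_Suc)
  with X show ?thesis by blast
qed

lemma bij_betw_Psi_biwords:
  assumes "length \<nu> = l" "length \<mu> = l"
  shows "bij_betw (\<lambda>X. map (Psi_biword l X) [1..<Suc l]) (ParMat l \<nu> \<mu>) (biword_tuples l \<nu> \<mu>)"
  unfolding bij_betw_def
proof (intro conjI equalityI subsetI inj_on_Psi_biwords)
  fix ws assume "ws \<in> biword_tuples l \<nu> \<mu>"
  from Psi_biwords_surj[OF this assms]
  show "ws \<in> (\<lambda>X. map (Psi_biword l X) [1..<Suc l]) ` ParMat l \<nu> \<mu>" by blast
qed (use Psi_biwords_in_tuples[OF _ assms] in blast)

section \<open>Tuples of biwords and pairs of multitableaux\<close>

text \<open>Used to count boxes: the image shapes have as many boxes as the content has letters,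
  which makes them a multipartition of \<open>n\<close>.\<close>

lemma size_alphabet:
  assumes "\<mu> \<in> multicompositions l n"
  shows "size (alphabet \<mu>) = n"
proof -
  have l: "length \<mu> = l" using assms by (simp add: multicompositions_def)
  have inner: "(\<Sum>a<length \<alpha>. if b' = b \<and> a' = Suc a then \<alpha> ! a else 0) =
      (if b' = b \<and> 1 \<le> a' then part \<alpha> a' else 0)" for \<alpha> and b b' a' :: nat
    by (cases "b = b'"; cases a') (auto simp: part_def nth_default_def)
  have "alphabet \<mu> = (\<Sum>b=1..l. \<Sum>a<length (component \<mu> b).
      replicate_mset (component \<mu> b ! a) (letter (Suc a) b))"
  proof (rule multiset_eqI)
    fix x :: letter
    obtain b' a' where x: "x = (b', a')" by fastforce
    show "count (alphabet \<mu>) x = count (\<Sum>b=1..l. \<Sum>a<length (component \<mu> b).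
      replicate_mset (component \<mu> b ! a) (letter (Suc a) b)) x"
      by (auto simp: x count_sum count_alphabet inner l)
  qed
  then have "size (alphabet \<mu>) = (\<Sum>b=1..l. \<Sum>a<length (component \<mu> b). component \<mu> b ! a)"
    by (simp add: size_multiset_sum)
  also have "\<dots> = (\<Sum>b=1..l. sum_list (component \<mu> b))"
    by (simp add: sum_list_sum_nth atLeast0LessThan)
  finally show ?thesis using assms by (simp add: multicompositions_def)
qed

lemma component_map: "length xs = l \<Longrightarrow> t \<in> {1..l} \<Longrightarrow> component (map f xs) t = f (component xs t)"
  by auto

lemma list_eq_component:
  assumes "length xs = l" "length ys = l" "\<And>t. t \<in> {1..l} \<Longrightarrow> component xs t = component ys t"
  shows "xs = ys"
proof (rule nth_equalityI)
  fix k assume "k < length xs"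
  with assms(1) assms(3)[of "Suc k"] show "xs ! k = ys ! k" by simp
qed (use assms in simp)

lemma letters_if_alphabet:
  fixes M :: "nat \<Rightarrow> letter multiset"
  assumes "(\<Sum>t=1..l. M t) = alphabet \<mu>" "t \<in> {1..l}"
  shows "set_mset (M t) \<subseteq> letters"
proof
  fix x assume "x \<in># M t"
  with assms(2) have "x \<in># alphabet \<mu>" by (auto simp: in_sum_mset_iff assms(1)[symmetric])
  then show "x \<in> letters" using in_alphabetD by (cases x) (fastforce simp: letters_def)
qed

lemma SSTD:
  assumes "T \<in> SST l \<Lambda> \<mu>"
  shows "length T = l" "\<And>t. t \<in> {1..l} \<Longrightarrow> semistandard (component T t)"
    "\<And>t. t \<in> {1..l} \<Longrightarrow> shape (component T t) = component \<Lambda> t"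
    "\<And>t. t \<in> {1..l} \<Longrightarrow> set_mset (entries (component T t)) \<subseteq> letters"
    "(\<Sum>t=1..l. entries (component T t)) = alphabet \<mu>"
    "\<And>t a b. t \<in> {1..l} \<Longrightarrow> letter a b \<in># entries (component T t) \<Longrightarrow> t \<le> b"
  using assms unfolding SST_def by blast+

text \<open>RSK acts on each component separately, and the conditions on the tuple only see the
  multisets of upper and lower letters, which RSK preserves. The shape is carried along to name the
  summand of the disjoint union.\<close>

lemma bij_betw_rsk_tuples:
  assumes \<mu>: "\<mu> \<in> multicompositions l n"
  shows "bij_betw
    (\<lambda>ws. (map (\<lambda>w. shape (fst (rsk w))) ws, map (\<lambda>w. fst (rsk w)) ws, map (\<lambda>w. snd (rsk w)) ws))
    (biword_tuples l \<nu> \<mu>) (SIGMA \<Lambda>:multipartitions l n. SST l \<Lambda> \<mu> \<times> SST l \<Lambda> \<nu>)"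
  (is "bij_betw ?f ?B ?S")
  unfolding bij_betw_def
proof (intro conjI equalityI subsetI inj_onI)
  fix ws vs assume ws: "ws \<in> ?B" and vs: "vs \<in> ?B" and eq: "?f ws = ?f vs"
  have len: "length ws = l" "length vs = l" using ws vs by (auto simp: biword_tuples_def)
  show "ws = vs"
  proof (rule list_eq_component[OF len])
    fix t assume t: "t \<in> {1..l}"
    from eq have "component (map (\<lambda>w. fst (rsk w)) ws) t = component (map (\<lambda>w. fst (rsk w)) vs) t"
      "component (map (\<lambda>w. snd (rsk w)) ws) t = component (map (\<lambda>w. snd (rsk w)) vs) t" by auto
    then have "rsk (component ws t) = rsk (component vs t)"
      unfolding component_map[OF len(1) t] component_map[OF len(2) t] by (rule prod_eqI)
    with ws vs t show "component ws t = component vs t"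
      by (intro rsk_inject) (auto simp: biword_tuples_def)
  qed
next
  fix Y assume "Y \<in> ?f ` ?B"
  then obtain ws where ws: "ws \<in> ?B" and Y: "Y = ?f ws" by blast
  have len: "length ws = l"
    and content: "(\<Sum>t=1..l. mset (map fst (component ws t))) = alphabet \<nu>"
      "(\<Sum>t=1..l. mset (map snd (component ws t))) = alphabet \<mu>"
    using ws by (auto simp: biword_tuples_def)
  let ?P = "\<lambda>t. fst (rsk (component ws t))" and ?Q = "\<lambda>t. snd (rsk (component ws t))"
  have rsk: "semistandard (?P t)" "semistandard (?Q t)" "shape (?Q t) = shape (?P t)"
    if "t \<in> {1..l}" for t
  proof -
    have "sorted (component ws t)" using ws that unfolding biword_tuples_def by blast
    from rsk_semistandard[OF this surjective_pairing]
    show "semistandard (?P t)" "semistandard (?Q t)" "shape (?Q t) = shape (?P t)" by simp_all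
  qed
  have le: "t \<le> p \<and> t \<le> q" if "t \<in> {1..l}" "((p, i), (q, j)) \<in> set (component ws t)"
    for t p i q j
  proof -
    have "\<forall>((p, i), (q, j))\<in>set (component ws t). t \<le> p \<and> t \<le> q"
      using ws that(1) unfolding biword_tuples_def by blast
    from bspec[OF this that(2)] show ?thesis by simp
  qed
  have support: "t \<le> b" if "t \<in> {1..l}" "letter a b \<in># entries (?P t)" for t a b
  proof -
    from that(2) obtain p i where "((p, i), (b, a)) \<in> set (component ws t)"
      by (auto simp: entries_rsk)
    from le[OF that(1) this] show ?thesis by simp
  qed
  have support': "t \<le> b" if "t \<in> {1..l}" "letter a b \<in># entries (?Q t)" for t a b
  proof -
    from that(2) obtain p i where "((b, a), (p, i)) \<in> set (component ws t)"
      by (auto simp: entries_rsk)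
    from le[OF that(1) this] show ?thesis by simp
  qed
  have sums: "(\<Sum>t=1..l. entries (?P t)) = alphabet \<mu>" "(\<Sum>t=1..l. entries (?Q t)) = alphabet \<nu>"
    using content by (simp_all add: entries_rsk)
  define \<Lambda> where "\<Lambda> = map (\<lambda>w. shape (fst (rsk w))) ws"
  have \<Lambda>: "length \<Lambda> = l" "\<And>t. t \<in> {1..l} \<Longrightarrow> component \<Lambda> t = shape (?P t)"
    using len component_map[OF len] by (auto simp: \<Lambda>_def)
  have "(\<Sum>t=1..l. sum_list (component \<Lambda> t)) = (\<Sum>t=1..l. size (entries (?P t)))"
    by (intro sum.cong refl) (simp only: \<Lambda>(2) size_entries)
  also have "\<dots> = n"
    unfolding size_multiset_sum[symmetric] sums(1) by (rule size_alphabet[OF \<mu>])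
  finally have "\<Lambda> \<in> multicompositions l n"
    unfolding multicompositions_def using \<Lambda>(1) by blast
  moreover have "is_partition (component \<Lambda> t)" if "t \<in> {1..l}" for t
    using rsk(1)[OF that] unfolding \<Lambda>(2)[OF that] semistandard_def by blast
  ultimately have "\<Lambda> \<in> multipartitions l n" unfolding multipartitions_def by blast
  moreover have "map (\<lambda>w. fst (rsk w)) ws \<in> SST l \<Lambda> \<mu>"
    unfolding SST_def
  proof (intro CollectI conjI ballI allI impI)
    show "(\<Sum>t=1..l. entries (component (map (\<lambda>w. fst (rsk w)) ws) t)) = alphabet \<mu>"
      unfolding sums(1)[symmetric] by (intro sum.cong refl) (simp only: component_map[OF len])
  qed (use len rsk support \<Lambda> letters_if_alphabet[OF sums(1)] in \<open>simp_all only: component_map length_map\<close>)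
  moreover have "map (\<lambda>w. snd (rsk w)) ws \<in> SST l \<Lambda> \<nu>"
    unfolding SST_def
  proof (intro CollectI conjI ballI allI impI)
    show "(\<Sum>t=1..l. entries (component (map (\<lambda>w. snd (rsk w)) ws) t)) = alphabet \<nu>"
      unfolding sums(2)[symmetric] by (intro sum.cong refl) (simp only: component_map[OF len])
  qed (use len rsk support' \<Lambda> letters_if_alphabet[OF sums(2)] in \<open>simp_all only: component_map length_map\<close>)
  ultimately show "Y \<in> ?S" unfolding Y \<Lambda>_def by simp
next
  fix Y assume "Y \<in> ?S"
  then obtain \<Lambda> T U where Y: "Y = (\<Lambda>, T, U)" and \<Lambda>: "\<Lambda> \<in> multipartitions l n"
    and T: "T \<in> SST l \<Lambda> \<mu>" and U: "U \<in> SST l \<Lambda> \<nu>" by auto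
  have len: "length T = l" "length U = l" "length \<Lambda> = l"
    using \<Lambda> SSTD(1)[OF T] SSTD(1)[OF U]
    unfolding multipartitions_def multicompositions_def by blast+
  have "\<exists>w. sorted w \<and> rsk w = (component T t, component U t)" if "t \<in> {1..l}" for t
    using SSTD(3)[OF T that] SSTD(3)[OF U that]
    by (intro rsk_surj SSTD(2)[OF T that] SSTD(2)[OF U that]) (simp only:)
  then obtain W where W: "\<And>t. t \<in> {1..l} \<Longrightarrow> sorted (W t)"
    "\<And>t. t \<in> {1..l} \<Longrightarrow> rsk (W t) = (component T t, component U t)"
    by metis
  define ws where "ws = map (\<lambda>k. W (Suc k)) [0..<l]"
  have ws: "length ws = l" "\<And>t. t \<in> {1..l} \<Longrightarrow> component ws t = W t"
    by (auto simp: ws_def)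
  have entries: "mset (map snd (W t)) = entries (component T t)"
    "mset (map fst (W t)) = entries (component U t)" if "t \<in> {1..l}" for t
    using entries_rsk[of "W t"] unfolding W(2)[OF that] by simp_all
  have "(\<Sum>t=1..l. mset (map fst (component ws t))) = alphabet \<nu>"
    unfolding SSTD(5)[OF U, symmetric] by (intro sum.cong refl) (simp only: ws(2) entries(2))
  moreover have "(\<Sum>t=1..l. mset (map snd (component ws t))) = alphabet \<mu>"
    unfolding SSTD(5)[OF T, symmetric] by (intro sum.cong refl) (simp only: ws(2) entries(1))
  moreover have "sorted (component ws t) \<and> (\<forall>((p, i), (q, j))\<in>set (component ws t). t \<le> p \<and> t \<le> q)"
    if t: "t \<in> {1..l}" for t
  proof -
    have "t \<le> p \<and> t \<le> q" if x: "((p, i), (q, j)) \<in> set (W t)" for p i q j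
    proof -
      have "(p, i) \<in># mset (map fst (W t))" "(q, j) \<in># mset (map snd (W t))"
        using x by force+
      then show ?thesis
        unfolding entries[OF t] using SSTD(6)[OF T t] SSTD(6)[OF U t] by blast
    qed
    then show ?thesis unfolding ws(2)[OF t] using W(1)[OF t] by auto
  qed
  ultimately have "ws \<in> ?B" using ws(1) unfolding biword_tuples_def by blast
  moreover have "?f ws = Y"
  proof -
    have "map (\<lambda>w. fst (rsk w)) ws = T" "map (\<lambda>w. snd (rsk w)) ws = U"
      by (rule list_eq_component[of _ l];
          simp only: length_map ws len component_map[OF ws(1)] W(2) fst_conv snd_conv)+
    moreover have "map shape T = \<Lambda>"
      by (rule list_eq_component[of _ l])
        (simp_all only: component_map[OF len(1)] length_map len SSTD(3)[OF T])
    moreover have "map (\<lambda>w. shape (fst (rsk w))) ws = map shape (map (\<lambda>w. fst (rsk w)) ws)"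
      by simp
    ultimately show ?thesis unfolding Y by simp
  qed
  ultimately show "Y \<in> ?f ` ?B" by blast
qed

lemma bij_betw_Psi:
  assumes "\<mu> \<in> multicompositions l n" "\<nu> \<in> multicompositions l n"
  shows "bij_betw (\<lambda>X. (map shape (fst (Psi l X)), Psi l X))
    (ParMat l \<nu> \<mu>) (SIGMA \<Lambda>:multipartitions l n. SST l \<Lambda> \<mu> \<times> SST l \<Lambda> \<nu>)"
proof -
  have "length \<nu> = l" "length \<mu> = l" using assms by (auto simp: multicompositions_def)
  from bij_betw_trans[OF bij_betw_Psi_biwords[OF this] bij_betw_rsk_tuples[OF assms(1)]]
  show ?thesis by (rule bij_betw_cong[THEN iffD1, rotated]) (simp add: Psi_def del: upt_Suc)
qed

section \<open>Empty last components\<close>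

lemma part_eq_0: "sum_list \<alpha> = 0 \<Longrightarrow> part \<alpha> i = 0"
  by (auto simp: part_def nth_default_def)

text \<open>Emptiness of a composition is expressed by a vanishing sum, because a composition may
  still list parts equal to 0; none of them contributes a letter.\<close>

lemma alphabet_butlast:
  assumes "length \<mu> = Suc m" "sum_list (\<mu> ! m) = 0"
  shows "alphabet (butlast \<mu>) = alphabet \<mu>"
proof (rule multiset_eqI)
  fix x :: letter
  obtain b a where x: "x = (b, a)" by fastforce
  show "count (alphabet (butlast \<mu>)) x = count (alphabet \<mu>) x"
  proof (cases "b = Suc m")
    case True
    then show ?thesis using assms by (simp add: x count_alphabet part_eq_0)
  next
    case False
    then show ?thesis using assms(1) by (auto simp: x count_alphabet nth_butlast)
  qed
qed

text \<open>A vanishing row or column sum kills all its nonnegative summands, and a partition whose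
  positive parts are bounded by 0 is empty.\<close>

lemma ParMat_last_blocks:
  assumes X: "(A, P) \<in> ParMat (Suc m) \<nu> \<mu>"
    and zero: "sum_list (\<mu> ! m) = 0" "sum_list (\<nu> ! m) = 0"
    and pq: "(p, q) \<in> blocks (Suc m)" "p = Suc m \<or> q = Suc m"
  shows "A (p, q) i j = 0" "P (p, q) i j = []"
proof -
  have mem: "A (p, q) \<in> nat_matrices" "P (p, q) \<in> partition_matrices"
    using ParMatD(1,2)[OF X] pq(1) by auto
  have fin: "finite {(i, j). A (p, q) i j \<noteq> 0}" using nat_matricesD(1)[OF mem(1)] .
  show A: "A (p, q) i j = 0"
  proof (cases "1 \<le> i \<and> 1 \<le> j")
    case True
    from pq(2) show ?thesis
    proof
      assume p: "p = Suc m"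
      have "(\<Sum>q=1..Suc m. \<Sum>j. A (p, q) i j) = 0"
        using ParMatD(3)[OF X, of p i] True p zero(2) by (simp add: part_eq_0)
      then have "(\<Sum>j. A (p, q) i j) = 0"
        unfolding sum_eq_0_iff[OF finite_atLeastAtMost] using pq(1) by blast
      \<comment> \<open>\<open>Sum_any\<close> also takes the value 0 on infinite supports, so
        finiteness is what allows passing from a zero sum to zero summands.\<close>
      moreover have "finite {j. A (p, q) i j \<noteq> 0}"
        using finite_vimageI[OF fin, of "Pair i"] by (simp add: vimage_def inj_def)
      ultimately show ?thesis by (simp add: fun_eq_iff)
    next
      assume q: "q = Suc m"
      have "(\<Sum>p=1..Suc m. \<Sum>i. A (p, q) i j) = 0"
        using ParMatD(4)[OF X, of q j] True q zero(1) by (simp add: part_eq_0)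
      then have "(\<Sum>i. A (p, q) i j) = 0"
        unfolding sum_eq_0_iff[OF finite_atLeastAtMost] using pq(1) by blast
      moreover have "finite {i. A (p, q) i j \<noteq> 0}"
        using finite_vimageI[OF fin, of "\<lambda>i. (i, j)"] by (simp add: vimage_def inj_def)
      ultimately show ?thesis by (simp add: fun_eq_iff)
    qed
  qed (use nat_matricesD(2,3)[OF mem(1)] in \<open>auto simp: not_le\<close>)
  show "P (p, q) i j = []"
  proof (cases "1 \<le> i \<and> 1 \<le> j")
    case True
    then have "x \<le> 0" if "x \<in> set (P (p, q) i j)" for x
      using ParMatD(5)[OF X pq(1) _ _ that] A by simp
    moreover have "0 < x" if "x \<in> set (P (p, q) i j)" for x
      using partition_matricesD(1)[OF mem(2)] that by (auto simp: is_partition_def)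
    ultimately have "set (P (p, q) i j) = {}" by (meson equals0I leD)
    then show ?thesis by simp
  qed (use partition_matricesD(3,4)[OF mem(2)] in \<open>auto simp: not_le\<close>)
qed

text \<open>The bound \<open>min p q - 1\<close> does not depend on the level, so the surviving
  blocks obey the same conditions before and after deletion. An equivalence is stated because
  deletion uses one direction and extension by zero blocks the other.\<close>

lemma ParMat_Suc_iff:
  assumes "length \<mu> = Suc m" "length \<nu> = Suc m" "sum_list (\<mu> ! m) = 0" "sum_list (\<nu> ! m) = 0"
    and A: "A \<in> extensional (blocks (Suc m))" and P: "P \<in> extensional (blocks (Suc m))"
    and zero: "\<And>p q i j. (p, q) \<in> blocks (Suc m) \<Longrightarrow> p = Suc m \<or> q = Suc m \<Longrightarrow>
      A (p, q) i j = 0 \<and> P (p, q) i j = []"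
  shows "(A, P) \<in> ParMat (Suc m) \<nu> \<mu> \<longleftrightarrow>
    delete_last_blocks (Suc m) (A, P) \<in> ParMat m (butlast \<nu>) (butlast \<mu>)"
proof -
  have zero_cases: "M \<in> nat_matrices" if "\<And>i j. M i j = 0" for M
    using that by (simp add: nat_matrices_def)
  have nil_cases: "M \<in> partition_matrices" if "\<And>i j. M i j = []" for M
    using that by (simp add: partition_matrices_def is_partition_def)
  have split: "(\<forall>p\<in>{1..Suc m}. \<forall>q\<in>{1..Suc m}. R p q) \<longleftrightarrow> (\<forall>p\<in>{1..m}. \<forall>q\<in>{1..m}. R p q)"
    if "\<And>p q. (p, q) \<in> blocks (Suc m) \<Longrightarrow> p = Suc m \<or> q = Suc m \<Longrightarrow> R p q" for R
    using that by (fastforce simp: le_Suc_eq)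
  have ball_blocks: "(\<forall>pq\<in>blocks k. R pq) \<longleftrightarrow> (\<forall>p\<in>{1..k}. \<forall>q\<in>{1..k}. R (p, q))" for R k
    by auto
  have "(\<forall>p\<in>{1..Suc m}. \<forall>q\<in>{1..Suc m}. A (p, q) \<in> nat_matrices) \<longleftrightarrow>
      (\<forall>p\<in>{1..m}. \<forall>q\<in>{1..m}. A (p, q) \<in> nat_matrices)"
    by (rule split, rule zero_cases, rule conjunct1, rule zero)
  then have mem_A: "A \<in> blocks (Suc m) \<rightarrow>\<^sub>E nat_matrices \<longleftrightarrow>
      restrict A (blocks m) \<in> blocks m \<rightarrow>\<^sub>E nat_matrices"
    using A unfolding PiE_iff ball_blocks by simp
  have "(\<forall>p\<in>{1..Suc m}. \<forall>q\<in>{1..Suc m}. P (p, q) \<in> partition_matrices) \<longleftrightarrow>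
      (\<forall>p\<in>{1..m}. \<forall>q\<in>{1..m}. P (p, q) \<in> partition_matrices)"
    by (rule split, rule nil_cases, rule conjunct2, rule zero)
  then have mem_P: "P \<in> blocks (Suc m) \<rightarrow>\<^sub>E partition_matrices \<longleftrightarrow>
      restrict P (blocks m) \<in> blocks m \<rightarrow>\<^sub>E partition_matrices"
    using P unfolding PiE_iff ball_blocks by simp
  have rows: "(\<Sum>q=1..Suc m. \<Sum>j. A (s, q) t j) =
      (if s = Suc m then 0 else \<Sum>q=1..m. \<Sum>j. restrict A (blocks m) (s, q) t j)"
    if "s \<in> {1..Suc m}" for s t
    using that zero by auto
  have columns: "(\<Sum>p=1..Suc m. \<Sum>i. A (p, s) i t) =
      (if s = Suc m then 0 else \<Sum>p=1..m. \<Sum>i. restrict A (blocks m) (p, s) i t)"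
    if "s \<in> {1..Suc m}" for s t
    using that zero by auto
  have split_last: "(\<forall>s\<in>{1..Suc m}. R s) \<longleftrightarrow> (\<forall>s\<in>{1..m}. R s)" if "R (Suc m)" for R
    using that by (simp add: atLeastAtMostSuc_conv)
  have rows_iff: "(\<forall>s\<in>{1..Suc m}. \<forall>t\<ge>1.
        (\<Sum>q=1..Suc m. \<Sum>j. A (s, q) t j) = part (component \<nu> s) t) \<longleftrightarrow>
      (\<forall>s\<in>{1..m}. \<forall>t\<ge>1.
        (\<Sum>q=1..m. \<Sum>j. restrict A (blocks m) (s, q) t j) = part (component (butlast \<nu>) s) t)"
  proof (subst split_last)
    show "\<forall>t\<ge>1. (\<Sum>q=1..Suc m. \<Sum>j. A (Suc m, q) t j) = part (component \<nu> (Suc m)) t"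
      by (subst rows) (auto simp: part_eq_0 assms(4))
  qed (intro ball_cong all_cong refl, subst rows, use assms(2) in \<open>auto simp: nth_butlast\<close>)
  have columns_iff: "(\<forall>s\<in>{1..Suc m}. \<forall>t\<ge>1.
        (\<Sum>p=1..Suc m. \<Sum>i. A (p, s) i t) = part (component \<mu> s) t) \<longleftrightarrow>
      (\<forall>s\<in>{1..m}. \<forall>t\<ge>1.
        (\<Sum>p=1..m. \<Sum>i. restrict A (blocks m) (p, s) i t) = part (component (butlast \<mu>) s) t)"
  proof (subst split_last)
    show "\<forall>t\<ge>1. (\<Sum>p=1..Suc m. \<Sum>i. A (p, Suc m) i t) = part (component \<mu> (Suc m)) t"
      by (subst columns) (auto simp: part_eq_0 assms(3))
  qed (intro ball_cong all_cong refl, subst columns, use assms(1) in \<open>auto simp: nth_butlast\<close>)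
  have bounds_iff: "(\<forall>p\<in>{1..Suc m}. \<forall>q\<in>{1..Suc m}. \<forall>i\<ge>1. \<forall>j\<ge>1.
        (\<forall>x\<in>set (P (p, q) i j). x \<le> A (p, q) i j) \<and> length (P (p, q) i j) \<le> min p q - 1) \<longleftrightarrow>
      (\<forall>p\<in>{1..m}. \<forall>q\<in>{1..m}. \<forall>i\<ge>1. \<forall>j\<ge>1.
        (\<forall>x\<in>set (restrict P (blocks m) (p, q) i j). x \<le> restrict A (blocks m) (p, q) i j) \<and>
        length (restrict P (blocks m) (p, q) i j) \<le> min p q - 1)"
    by (subst split) (use zero in auto)
  show ?thesis
    unfolding ParMat_def delete_last_blocks_def mem_Collect_eq prod.case diff_Suc_1
      mem_A mem_P rows_iff columns_iff bounds_iff ..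
qed

lemma restrict_extend:
  assumes "f \<in> extensional S" "S \<subseteq> S'"
  shows "restrict (\<lambda>x\<in>S'. if x \<in> S then f x else z) S = f"
  using assms by (auto simp: extensional_def restrict_def fun_eq_iff)

lemma extend_restrict:
  assumes "f \<in> extensional S'" "\<And>x. x \<in> S' \<Longrightarrow> x \<notin> S \<Longrightarrow> f x = z"
  shows "(\<lambda>x\<in>S'. if x \<in> S then restrict f S x else z) = f"
  using assms by (auto simp: extensional_def restrict_def fun_eq_iff)

lemma bij_betw_delete_last_blocks:
  assumes "length \<mu> = Suc m" "length \<nu> = Suc m" "sum_list (\<mu> ! m) = 0" "sum_list (\<nu> ! m) = 0"
  shows "bij_betw (delete_last_blocks (Suc m))
    (ParMat (Suc m) \<nu> \<mu>) (ParMat m (butlast \<nu>) (butlast \<mu>))"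
proof (rule bij_betw_byWitness)
  let ?ext = "\<lambda>(A, P). (\<lambda>pq\<in>blocks (Suc m). if pq \<in> blocks m then A pq else (\<lambda>_ _. 0),
    \<lambda>pq\<in>blocks (Suc m). if pq \<in> blocks m then P pq else (\<lambda>_ _. []))"
  have blocks: "fst pq = Suc m \<or> snd pq = Suc m" if "pq \<in> blocks (Suc m)" "pq \<notin> blocks m" for pq
    using that by auto
  show "\<forall>X\<in>ParMat (Suc m) \<nu> \<mu>. ?ext (delete_last_blocks (Suc m) X) = X"
  proof
    fix X assume "X \<in> ParMat (Suc m) \<nu> \<mu>"
    then obtain A P where AP: "X = (A, P)" and X: "(A, P) \<in> ParMat (Suc m) \<nu> \<mu>" by (cases X) auto
    have zero: "A pq = (\<lambda>_ _. 0)" "P pq = (\<lambda>_ _. [])" if "pq \<in> blocks (Suc m)" "pq \<notin> blocks m" for pq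
      using ParMat_last_blocks[OF X assms(3,4), of "fst pq" "snd pq"] that(1) blocks[OF that]
      by (auto intro!: ext)
    have ext: "A \<in> extensional (blocks (Suc m))" "P \<in> extensional (blocks (Suc m))"
      using ParMatD(1,2)[OF X] by (simp_all only: PiE_iff)
    show "?ext (delete_last_blocks (Suc m) X) = X"
      unfolding AP delete_last_blocks_def prod.case diff_Suc_1
      by (rule arg_cong2[where f = Pair, OF extend_restrict[OF ext(1) zero(1)]
            extend_restrict[OF ext(2) zero(2)]])
  qed
  have sub: "blocks m \<subseteq> blocks (Suc m)" by auto
  have ext: "A \<in> extensional (blocks m)" "P \<in> extensional (blocks m)"
    if "(A, P) \<in> ParMat m (butlast \<nu>) (butlast \<mu>)" for A P
    using ParMatD(1,2)[OF that] by (simp_all only: PiE_iff)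
  have id: "delete_last_blocks (Suc m) (?ext (A, P)) = (A, P)"
    if "(A, P) \<in> ParMat m (butlast \<nu>) (butlast \<mu>)" for A P
    unfolding delete_last_blocks_def prod.case diff_Suc_1
    by (simp only: restrict_extend[OF ext(1)[OF that] sub] restrict_extend[OF ext(2)[OF that] sub])
  show "\<forall>X\<in>ParMat m (butlast \<nu>) (butlast \<mu>). delete_last_blocks (Suc m) (?ext X) = X"
  proof
    fix X assume X: "X \<in> ParMat m (butlast \<nu>) (butlast \<mu>)"
    obtain A P where AP: "X = (A, P)" by (rule prod.exhaust)
    show "delete_last_blocks (Suc m) (?ext X) = X"
      using X unfolding AP by (rule id)
  qed
  show "delete_last_blocks (Suc m) ` ParMat (Suc m) \<nu> \<mu> \<subseteq> ParMat m (butlast \<nu>) (butlast \<mu>)"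
  proof (rule image_subsetI)
    fix Z assume Z: "Z \<in> ParMat (Suc m) \<nu> \<mu>"
    obtain A P where AP: "Z = (A, P)" by (rule prod.exhaust)
    note X = Z[unfolded AP]
    have ext: "A \<in> extensional (blocks (Suc m))" "P \<in> extensional (blocks (Suc m))"
      using ParMatD(1,2)[OF X] by (simp_all only: PiE_iff)
    show "delete_last_blocks (Suc m) Z \<in> ParMat m (butlast \<nu>) (butlast \<mu>)"
      unfolding AP
    proof (rule iffD1[OF ParMat_Suc_iff[OF assms ext] X])
      fix p q i j assume "(p, q) \<in> blocks (Suc m)" "p = Suc m \<or> q = Suc m"
      from ParMat_last_blocks[OF X assms(3,4) this]
      show "A (p, q) i j = 0 \<and> P (p, q) i j = []" by (intro conjI)
    qed
  qed
  show "?ext ` ParMat m (butlast \<nu>) (butlast \<mu>) \<subseteq> ParMat (Suc m) \<nu> \<mu>"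
  proof
    fix X assume "X \<in> ?ext ` ParMat m (butlast \<nu>) (butlast \<mu>)"
    then obtain Z where Z: "X = ?ext Z" "Z \<in> ParMat m (butlast \<nu>) (butlast \<mu>)"
      by (rule imageE)
    obtain A P where AP: "Z = (A, P)" by (rule prod.exhaust)
    note X = Z(1)[unfolded AP] and Y = Z(2)[unfolded AP]
    obtain A' P' where ext: "?ext (A, P) = (A', P')" by fastforce
    have "(A', P') \<in> ParMat (Suc m) \<nu> \<mu>"
    proof (rule iffD2[OF ParMat_Suc_iff[OF assms]])
      show "delete_last_blocks (Suc m) (A', P') \<in> ParMat m (butlast \<nu>) (butlast \<mu>)"
        unfolding ext[symmetric] id[OF Y] by (rule Y)
    qed (use ext in auto)
    then show "X \<in> ParMat (Suc m) \<nu> \<mu>" by (simp only: X ext)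
  qed
qed

section \<open>The map on pairs with trivial last blocks\<close>

lemma biword_of_0: "biword_of (\<lambda>_. 0) = []"
  by (simp add: biword_of_def zero_multiset.abs_eq[symmetric])

lemma profile_0_Nil: "profile 0 [] k = 0"
  by (cases k) (simp_all add: profile_def)

text \<open>The biword number \<open>Suc m\<close> admits only biletters with both subscripts equal
  to \<open>Suc m\<close>, and these belong to the vanishing blocks. In the other blocks the
  multiplicity formula does not mention the level.\<close>

lemma Psi_last_component:
  assumes "(A, P) \<in> ParMat (Suc m) \<nu> \<mu>" "sum_list (\<mu> ! m) = 0" "sum_list (\<nu> ! m) = 0"
  shows "Psi_biword (Suc m) (A, P) (Suc m) = []"
    and "Psi_biword m (delete_last_blocks (Suc m) (A, P)) t = Psi_biword (Suc m) (A, P) t"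
proof -
  have last: "Psi_multiplicity (Suc m) (A, P) t ((p, i), (q, j)) = 0"
    if "(p, q) \<notin> blocks m" for t p i q j
  proof (cases "(p, q) \<in> blocks (Suc m)")
    case True
    with that have "p = Suc m \<or> q = Suc m" by auto
    from ParMat_last_blocks[OF assms True this] show ?thesis
      by (simp add: Psi_multiplicity_def profile_0_Nil)
  qed (auto simp: Psi_multiplicity_def)
  have "Psi_multiplicity (Suc m) (A, P) (Suc m) ((p, i), (q, j)) = 0" for p i q j
    using last[of p q "Suc m" i j] Psi_multiplicity_support(4)[OF assms(1), of "Suc m" p i q j]
    by fastforce
  then have "Psi_multiplicity (Suc m) (A, P) (Suc m) = (\<lambda>_. 0)" by auto
  then show "Psi_biword (Suc m) (A, P) (Suc m) = []"
    by (simp add: Psi_biword_eq biword_of_0)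
  have "Psi_multiplicity m (delete_last_blocks (Suc m) (A, P)) t ((p, i), (q, j)) =
      Psi_multiplicity (Suc m) (A, P) t ((p, i), (q, j))" for p i q j
  proof (cases "(p, q) \<in> blocks m")
    case True
    then show ?thesis by (auto simp: Psi_multiplicity_def delete_last_blocks_def)
  next
    case False
    with last show ?thesis by (auto simp: Psi_multiplicity_def delete_last_blocks_def)
  qed
  then have "Psi_multiplicity m (delete_last_blocks (Suc m) (A, P)) t =
      Psi_multiplicity (Suc m) (A, P) t" by auto
  then show "Psi_biword m (delete_last_blocks (Suc m) (A, P)) t = Psi_biword (Suc m) (A, P) t"
    by (simp add: Psi_biword_eq)
qed

lemma Psi_Suc:
  assumes "(A, P) \<in> ParMat (Suc m) \<nu> \<mu>" "sum_list (\<mu> ! m) = 0" "sum_list (\<nu> ! m) = 0"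
  shows "map shape (fst (Psi (Suc m) (A, P))) ! m = []"
    and "Psi m (delete_last_blocks (Suc m) (A, P)) = map_prod butlast butlast (Psi (Suc m) (A, P))"
  using Psi_last_component[OF assms] by (simp_all add: Psi_def nth_append)

text \<open>The inverse appends the constant \<open>c\<close>; this is applied with
  \<open>c = []\<close> to multipartitions and to multitableaux alike.\<close>

lemma bij_betw_butlast:
  assumes "\<And>xs. xs \<in> S \<Longrightarrow> length xs = Suc m \<and> xs ! m = c"
    "\<And>ys. length ys = m \<Longrightarrow> ys @ [c] \<in> S \<longleftrightarrow> ys \<in> S'" "\<And>ys. ys \<in> S' \<Longrightarrow> length ys = m"
  shows "bij_betw butlast S S'"
proof (rule bij_betw_byWitness[where f' = "\<lambda>ys. ys @ [c]"])
  show id: "\<forall>xs\<in>S. butlast xs @ [c] = xs"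
  proof
    fix xs assume "xs \<in> S"
    with assms(1) have "length xs = Suc m" "xs ! m = c" by auto
    moreover from this have "xs \<noteq> []" by auto
    ultimately have "xs \<noteq> []" "last xs = c" by (simp_all add: last_conv_nth)
    then show "butlast xs @ [c] = xs" by auto
  qed
  show "butlast ` S \<subseteq> S'"
  proof clarify
    fix xs assume "xs \<in> S"
    with id assms(1) have "butlast xs @ [c] \<in> S" "length (butlast xs) = m" by auto
    with assms(2) show "butlast xs \<in> S'" by blast
  qed
qed (use assms(2,3) in auto)

lemma bij_betw_butlast_multipartitions:
  "bij_betw butlast {\<Lambda> \<in> multipartitions (Suc m) n. \<Lambda> ! m = []} (multipartitions m n)"
proof (rule bij_betw_butlast)
  fix \<Lambda> :: "nat list list" assume "length \<Lambda> = m"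
  then have comp: "component (\<Lambda> @ [[]]) i = component \<Lambda> i" if "i \<in> {1..m}" for i
    using that by (auto simp: nth_append)
  have "(\<Sum>i=1..m. sum_list (component (\<Lambda> @ [[]]) i)) = (\<Sum>i=1..m. sum_list (component \<Lambda> i))"
    by (intro sum.cong refl) (simp only: comp)
  then show "\<Lambda> @ [[]] \<in> {\<Lambda> \<in> multipartitions (Suc m) n. \<Lambda> ! m = []} \<longleftrightarrow> \<Lambda> \<in> multipartitions m n"
    using \<open>length \<Lambda> = m\<close> comp
    by (auto simp: multipartitions_def multicompositions_def atLeastAtMostSuc_conv nth_append
        is_partition_def)
qed (auto simp: multipartitions_def multicompositions_def)

lemma bij_betw_butlast_SST:
  assumes "length \<mu> = Suc m" "sum_list (\<mu> ! m) = 0" "length \<Lambda> = Suc m" "\<Lambda> ! m = []"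
  shows "bij_betw butlast (SST (Suc m) \<Lambda> \<mu>) (SST m (butlast \<Lambda>) (butlast \<mu>))"
proof (rule bij_betw_butlast)
  fix T :: "letter tableau list" assume "length T = m"
  then have comp: "component (T @ [[]]) i = component T i" "component (butlast \<Lambda>) i = component \<Lambda> i"
    if "i \<in> {1..m}" for i
    using that assms(3) by (auto simp: nth_append nth_butlast)
  have "(\<Sum>i=1..m. entries (component (T @ [[]]) i)) = (\<Sum>i=1..m. entries (component T i))"
    by (intro sum.cong refl) (simp only: comp)
  then have sum: "(\<Sum>i=1..Suc m. entries (component (T @ [[]]) i)) = (\<Sum>i=1..m. entries (component T i))"
    using \<open>length T = m\<close> by (simp add: nth_append)
  have last: "component (T @ [[]]) (Suc m) = []" using \<open>length T = m\<close> by (simp add: nth_append)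
  have split: "(\<forall>i\<in>{1..Suc m}. R i) \<longleftrightarrow> R (Suc m) \<and> (\<forall>i\<in>{1..m}. R i)" for R
    by (simp add: atLeastAtMostSuc_conv)
  show "T @ [[]] \<in> SST (Suc m) \<Lambda> \<mu> \<longleftrightarrow> T \<in> SST m (butlast \<Lambda>) (butlast \<mu>)"
    unfolding SST_def mem_Collect_eq sum split last alphabet_butlast[OF assms(1,2)]
    using \<open>length T = m\<close> assms(4) by (simp add: comp del: One_nat_def)
next
  fix T assume "T \<in> SST (Suc m) \<Lambda> \<mu>"
  then show "length T = Suc m \<and> T ! m = []"
    using assms(4) by (auto simp: SST_def shape_def dest!: bspec[of _ _ "Suc m"])
qed (simp add: SST_def)

section \<open>Level one\<close>

text \<open>The length bound is \<open>min 1 1 - 1 = 0\<close>.\<close>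

lemma ParMat_1_Nil:
  assumes "(A, P) \<in> ParMat 1 \<nu> \<mu>"
  shows "P (1, 1) i j = []"
proof (cases "1 \<le> i \<and> 1 \<le> j")
  case True
  then show ?thesis using ParMatD(6)[OF assms, of 1 1 i j] by simp
next
  case False
  have "P (1, 1) \<in> partition_matrices" using ParMatD(2)[OF assms] by (rule PiE_mem) simp
  with False show ?thesis using partition_matricesD(3,4) by (cases i; cases j) auto
qed

lemma bij_betw_single_matrix:
  assumes "length \<mu> = 1" "length \<nu> = 1"
  shows "bij_betw (\<lambda>(A, P). A (1, 1)) (ParMat 1 \<nu> \<mu>)
    (matrices_with_sums (component \<nu> 1) (component \<mu> 1))"
proof (rule bij_betw_byWitness)
  let ?f = "\<lambda>(A, P :: nat \<times> nat \<Rightarrow> nat \<Rightarrow> nat \<Rightarrow> nat list). A (1, 1) :: nat \<Rightarrow> nat \<Rightarrow> nat"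
  let ?S = "matrices_with_sums (component \<nu> 1) (component \<mu> 1)"
  let ?g = "\<lambda>M. (\<lambda>_\<in>blocks 1. M, \<lambda>_\<in>blocks 1. \<lambda>_ _. [])"
  show "\<forall>X\<in>ParMat 1 \<nu> \<mu>. ?g (?f X) = X"
  proof
    fix X assume X: "X \<in> ParMat 1 \<nu> \<mu>"
    obtain A P where AP: "X = (A, P)" by (rule prod.exhaust)
    note X = X[unfolded AP]
    have "P (1, 1) = (\<lambda>_ _. [])" by (intro ext ParMat_1_Nil[OF X])
    moreover have "A \<in> extensional (blocks 1)" "P \<in> extensional (blocks 1)"
      using ParMatD(1,2)[OF X] by (simp_all only: PiE_iff)
    ultimately show "?g (?f X) = X" by (auto simp: AP extensional_def fun_eq_iff)
  qed
  show "\<forall>M\<in>?S. ?f (?g M) = M" by simp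
  show "?f ` ParMat 1 \<nu> \<mu> \<subseteq> ?S"
  proof (rule image_subsetI)
    fix X assume X: "X \<in> ParMat 1 \<nu> \<mu>"
    obtain A P where AP: "X = (A, P)" by (rule prod.exhaust)
    note X = X[unfolded AP]
    have "A (1, 1) \<in> nat_matrices" using ParMatD(1)[OF X] by (rule PiE_mem) simp
    then show "?f X \<in> ?S"
      using ParMatD(3,4)[OF X, of 1] by (simp add: AP matrices_with_sums_def)
  qed
  show "?g ` ?S \<subseteq> ParMat 1 \<nu> \<mu>"
  proof (rule image_subsetI)
    fix M assume M: "M \<in> ?S"
    have "(\<lambda>_\<in>blocks 1. M) \<in> blocks 1 \<rightarrow>\<^sub>E nat_matrices"
      using M by (simp add: matrices_with_sums_def)
    moreover have "(\<lambda>_\<in>blocks 1. \<lambda>_ _. []) \<in> blocks 1 \<rightarrow>\<^sub>E partition_matrices"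
      by (simp add: partition_matrices_def is_partition_def)
    ultimately show "?g M \<in> ParMat 1 \<nu> \<mu>"
      using M by (simp add: ParMat_def matrices_with_sums_def)
  qed
qed

section \<open>Numbers as letters with subscript 1\<close>

lemma shape_map [simp]: "shape (map (map g) T) = shape T"
  by (simp add: shape_def)

lemma entries_map: "entries (map (map g) T) = image_mset g (entries T)"
  by (induction T) auto

lemma semistandard_map:
  assumes "strict_mono g"
  shows "semistandard (map (map g) T) \<longleftrightarrow> semistandard T"
proof -
  have "sorted (map g r) \<longleftrightarrow> sorted r" for r
    by (simp add: sorted_map strict_mono_less_eq[OF assms])
  moreover have "column_less (map g r) (map g s) \<longleftrightarrow> column_less r s" for r s
    by (auto simp: column_less_def strict_mono_less[OF assms])
  ultimately show ?thesis
    by (induction T) (auto simp: semistandard_Cons hd_map)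
qed

lemma strict_mono_letter: "strict_mono (\<lambda>a. letter a b)"
  by (rule strict_monoI) (simp add: less_prod_def)

lemma count_image_letter:
  "count (image_mset (\<lambda>a. letter a c) E) (letter a b) = (if b = c then count E a else 0)"
  by (induction E) auto

text \<open>Being letters and having subscript at least 1 both follow from the content, so at level
  one only shape, semistandardness and content remain.\<close>

lemma to_letters_in_SST_iff:
  assumes "length \<mu> = 1"
  shows "[to_letters T] \<in> SST 1 [\<Lambda>] \<mu> \<longleftrightarrow> T \<in> SST_content \<Lambda> (component \<mu> 1)"
proof -
  let ?E = "entries T"
  have entries: "entries (to_letters T) = image_mset (\<lambda>a. letter a 1) ?E"
    by (simp add: to_letters_def entries_map)
  have content: "entries (to_letters T) = alphabet \<mu> \<longleftrightarrow>
      (\<forall>a. count ?E a = (if 1 \<le> a then part (component \<mu> 1) a else 0))"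
  proof
    assume "entries (to_letters T) = alphabet \<mu>"
    from arg_cong[OF this, of "\<lambda>M. count M (letter a 1)" for a]
    show "\<forall>a. count ?E a = (if 1 \<le> a then part (component \<mu> 1) a else 0)"
      unfolding entries count_image_letter count_alphabet using assms by simp
  next
    assume *: "\<forall>a. count ?E a = (if 1 \<le> a then part (component \<mu> 1) a else 0)"
    show "entries (to_letters T) = alphabet \<mu>"
    proof (rule multiset_eqI)
      fix x :: letter
      obtain b a where x: "x = (b, a)" by (rule prod.exhaust)
      show "count (entries (to_letters T)) x = count (alphabet \<mu>) x"
        unfolding entries x count_image_letter count_alphabet using * assms by auto
    qed
  qed
  have support: "set_mset (entries (to_letters T)) \<subseteq> letters"
    "letter a b \<in># entries (to_letters T) \<Longrightarrow> 1 \<le> b"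
    if "entries (to_letters T) = alphabet \<mu>" for a b
    using in_alphabetD[of _ _ \<mu>] unfolding that by (auto simp: letters_def)
  have rows: "semistandard (to_letters T) \<longleftrightarrow> semistandard T" "shape (to_letters T) = shape T"
    using semistandard_map[OF strict_mono_letter] by (auto simp: to_letters_def)
  have SST: "[U] \<in> SST 1 [\<Lambda>] \<mu> \<longleftrightarrow> semistandard U \<and> shape U = \<Lambda> \<and>
      set_mset (entries U) \<subseteq> letters \<and> entries U = alphabet \<mu> \<and>
      (\<forall>a b. letter a b \<in># entries U \<longrightarrow> 1 \<le> b)" for U
    by (simp add: SST_def)
  have SST_content: "T \<in> SST_content \<Lambda> (component \<mu> 1) \<longleftrightarrow>
      semistandard T \<and> shape T = \<Lambda> \<and> entries (to_letters T) = alphabet \<mu>"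
    unfolding content SST_content_def by simp
  show ?thesis
    unfolding SST SST_content rows using support by meson
qed

lemma inj_to_letters: "inj to_letters"
proof (rule injI)
  fix S T assume "to_letters S = to_letters T"
  then have "map (map snd) (to_letters S) = map (map snd) (to_letters T)" by simp
  then show "S = T" by (simp add: to_letters_def comp_def)
qed

lemma bij_betw_to_letters:
  assumes "length \<mu> = 1"
  shows "bij_betw (\<lambda>T. [to_letters T]) (SST_content \<Lambda> (component \<mu> 1)) (SST 1 [\<Lambda>] \<mu>)"
  unfolding bij_betw_def
proof (intro conjI equalityI subsetI)
  show "inj_on (\<lambda>T. [to_letters T]) (SST_content \<Lambda> (component \<mu> 1))"
    using inj_to_letters by (auto intro!: inj_onI dest: injD)
next
  fix S assume S: "S \<in> SST 1 [\<Lambda>] \<mu>"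
  from SSTD(1)[OF S] obtain T where T: "S = [T]" by (metis One_nat_def length_Suc_conv length_0_conv)
  have alphabet: "entries T = alphabet \<mu>" using SSTD(5)[OF S] by (simp add: T)
  have "fst x = 1" if "r \<in> set T" "x \<in> set r" for r x
  proof -
    have "x \<in># entries T" using that by (auto simp: in_entries_iff)
    with in_alphabetD(1)[of "fst x" "snd x" \<mu>] assms show ?thesis by (simp add: alphabet)
  qed
  then have "map (\<lambda>x. letter (snd x) 1) r = r" if "r \<in> set T" for r
    using that by (intro map_idI prod_eqI) auto
  then have eq: "T = to_letters (map (map snd) T)"
    by (simp add: to_letters_def comp_def map_idI)
  with S T have "map (map snd) T \<in> SST_content \<Lambda> (component \<mu> 1)"
    using to_letters_in_SST_iff[OF assms] by metis
  with eq T show "S \<in> (\<lambda>T. [to_letters T]) ` SST_content \<Lambda> (component \<mu> 1)" by blast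
qed (use to_letters_in_SST_iff[OF assms] in blast)

lemma count_image_letters:
  "count (image_mset (map_prod (\<lambda>a. letter a 1) (\<lambda>a. letter a 1)) W) ((p, i), (q, j)) =
    (if p = 1 \<and> q = 1 then count W (i, j) else 0)"
  by (induction W) auto

text \<open>The only difference is that of the matrix entry and 0. Relabelling is monotone on
  biletters, so the relabelled word is still sorted, and a biword is determined by its
  multiplicities.\<close>

lemma Psi_biword_1:
  assumes X: "(A, P) \<in> ParMat 1 \<nu> \<mu>"
  shows "Psi_biword 1 (A, P) 1 =
    map (map_prod (\<lambda>a. letter a 1) (\<lambda>a. letter a 1)) (biword_of (\<lambda>(i, j). A (1, 1) i j))"
proof -
  let ?h = "map_prod (\<lambda>a. letter a 1) (\<lambda>a. letter a 1)" and ?w = "biword_of (\<lambda>(i, j). A (1, 1) i j)"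
  have A: "A (1, 1) \<in> nat_matrices" using ParMatD(1)[OF X] by (rule PiE_mem) simp
  have "finite {x. 0 < (case x of (i, j) \<Rightarrow> A (1, 1) i j)}"
    using nat_matricesD(1)[OF A] by (simp add: case_prod_unfold)
  from biword_of_unique[OF this, of ?w] have
    w: "sorted ?w" "count (mset ?w) = (\<lambda>(i, j). A (1, 1) i j)" by (simp_all add: biword_iff_sorted)
  have "mono ?h" by (rule monoI) (auto simp: less_eq_prod_def less_prod_def)
  then have "sorted (map ?h ?w)"
    using w(1) by (auto simp: sorted_map intro: sorted_wrt_mono_rel[of _ "(\<le>)"] dest: monoD)
  moreover have "count (mset (map ?h ?w)) ((p, i), (q, j)) =
      Psi_multiplicity 1 (A, P) 1 ((p, i), (q, j))" for p i q j
  proof -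
    have "A (1, 1) i j = 0" if "i = 0 \<or> j = 0"
      using that nat_matricesD(2,3)[OF A] by auto
    then show ?thesis
      unfolding mset_map count_image_letters w(2)
      by (auto simp: Psi_multiplicity_def ParMat_1_Nil[OF X, simplified] profile_def Suc_le_eq)
  qed
  then have "count (mset (map ?h ?w)) = Psi_multiplicity 1 (A, P) 1" by auto
  ultimately have "biword (map ?h ?w) \<and> count (mset (map ?h ?w)) = Psi_multiplicity 1 (A, P) 1"
    by (simp only: biword_iff_sorted)
  from iffD1[OF biword_of_unique[OF finite_Psi_multiplicity[OF X]] this] show ?thesis
    unfolding Psi_biword_eq by (rule sym)
qed

lemma Psi_1:
  assumes "(A, P) \<in> ParMat 1 \<nu> \<mu>"
  shows "Psi 1 (A, P) =
    map_prod (\<lambda>T. [to_letters T]) (\<lambda>T. [to_letters T]) (rsk_matrix (A (1, 1)))"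
proof -
  have "rsk (Psi_biword 1 (A, P) 1) = map_prod to_letters to_letters (rsk_matrix (A (1, 1)))"
    unfolding Psi_biword_1[OF assms] rsk_map[OF strict_mono_letter] rsk_matrix_def to_letters_def ..
  then show ?thesis by (simp add: Psi_def map_prod_def split_beta)
qed

text \<open>Moves a bijection \<open>f\<close> along identifications \<open>p\<close> of the sources
  and \<open>h\<close> of the targets. It yields the usual RSK correspondence from the level-one
  case, without a second inversion argument.\<close>

lemma bij_betw_transport:
  assumes "bij_betw f X Y" "bij_betw p X S" "inj h"
    "\<And>x. x \<in> X \<Longrightarrow> f x = h (g (p x))" "\<And>z. h z \<in> Y \<longleftrightarrow> z \<in> Z"
  shows "bij_betw g S Z"
proof -
  have S: "S = p ` X" using assms(2) by (simp add: bij_betw_def)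
  have "inj_on g S"
    unfolding S using assms(1,4) by (auto simp: inj_on_def bij_betw_def)
  moreover have "g ` S = Z"
  proof (intro equalityI subsetI)
    fix z assume "z \<in> g ` S"
    then obtain x where "x \<in> X" "z = g (p x)" by (auto simp: S)
    with assms(1,4,5) show "z \<in> Z" by (metis bij_betwE)
  next
    fix z assume "z \<in> Z"
    with assms(5) have "h z \<in> Y" by blast
    with assms(1) obtain x where "x \<in> X" "h z = f x" by (auto simp: bij_betw_def)
    with assms(3,4) have "z = g (p x)" by (metis injD)
    with \<open>x \<in> X\<close> show "z \<in> g ` S" by (auto simp: S)
  qed
  ultimately show ?thesis by (simp add: bij_betw_def)
qed

lemma bij_betw_rsk_matrix:
  assumes "\<mu> \<in> multicompositions 1 n" "\<nu> \<in> multicompositions 1 n"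
  shows "bij_betw (\<lambda>M. (shape (fst (rsk_matrix M)), rsk_matrix M))
    (matrices_with_sums (component \<nu> 1) (component \<mu> 1))
    (SIGMA \<Lambda>:{\<Lambda>. is_partition \<Lambda> \<and> sum_list \<Lambda> = n}.
       SST_content \<Lambda> (component \<mu> 1) \<times> SST_content \<Lambda> (component \<nu> 1))"
proof (rule bij_betw_transport[OF bij_betw_Psi[OF assms]])
  have len: "length \<mu> = 1" "length \<nu> = 1" using assms by (simp_all add: multicompositions_def)
  let ?h = "\<lambda>(\<Lambda>, P, Q). ([\<Lambda>], [to_letters P], [to_letters Q])"
  show "bij_betw (\<lambda>(A, P). A (1, 1)) (ParMat 1 \<nu> \<mu>)
      (matrices_with_sums (component \<nu> 1) (component \<mu> 1))"
    by (rule bij_betw_single_matrix[OF len])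
  show "inj ?h" using inj_to_letters by (auto intro!: injI dest: injD)
  show "(map shape (fst (Psi 1 X)), Psi 1 X) =
      ?h (shape (fst (rsk_matrix (case X of (A, P) \<Rightarrow> A (1, 1)))),
        rsk_matrix (case X of (A, P) \<Rightarrow> A (1, 1)))"
    if "X \<in> ParMat 1 \<nu> \<mu>" for X
  proof -
    obtain A P where AP: "X = (A, P)" by (rule prod.exhaust)
    from Psi_1[OF that[unfolded AP]] show ?thesis
      by (simp add: AP to_letters_def split_beta map_prod_def)
  qed
  show "?h Z \<in> (SIGMA \<Lambda>:multipartitions 1 n. SST 1 \<Lambda> \<mu> \<times> SST 1 \<Lambda> \<nu>) \<longleftrightarrow>
      Z \<in> (SIGMA \<Lambda>:{\<Lambda>. is_partition \<Lambda> \<and> sum_list \<Lambda> = n}.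
        SST_content \<Lambda> (component \<mu> 1) \<times> SST_content \<Lambda> (component \<nu> 1))" for Z
  proof -
    obtain \<Lambda> P Q where Z: "Z = (\<Lambda>, P, Q)" by (metis surj_pair)
    have "[\<Lambda>] \<in> multipartitions 1 n \<longleftrightarrow> is_partition \<Lambda> \<and> sum_list \<Lambda> = n"
      by (auto simp: multipartitions_def multicompositions_def)
    then show ?thesis
      using to_letters_in_SST_iff[OF len(1), of P \<Lambda>] to_letters_in_SST_iff[OF len(2), of Q \<Lambda>]
      by (simp only: Z prod.case mem_Sigma_iff mem_Collect_eq)
  qed
qed

theorem theorem4p1:
  fixes l n :: nat and \<mu> \<nu> :: "nat list list"
  assumes "l \<ge> 1" and "n \<ge> 1"
    and "\<mu> \<in> multicompositions l n" and "\<nu> \<in> multicompositions l n"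
  shows
    "bij_betw (\<lambda>X. (map shape (fst (Psi l X)), Psi l X))
       (ParMat l \<nu> \<mu>)
       (SIGMA \<Lambda>:multipartitions l n. SST l \<Lambda> \<mu> \<times> SST l \<Lambda> \<nu>)
     \<and>
     (l \<ge> 2 \<and> sum_list (component \<mu> l) = 0 \<and> sum_list (component \<nu> l) = 0 \<longrightarrow>
        bij_betw (delete_last_blocks l)
          (ParMat l \<nu> \<mu>) (ParMat (l - 1) (butlast \<nu>) (butlast \<mu>)) \<and>
        bij_betw butlast
          {\<Lambda> \<in> multipartitions l n. component \<Lambda> l = []} (multipartitions (l - 1) n) \<and>
        (\<forall>\<Lambda> \<in> multipartitions l n. component \<Lambda> l = [] \<longrightarrow>
           (\<forall>T \<in> SST l \<Lambda> \<mu> \<union> SST l \<Lambda> \<nu>. component T l = []) \<and>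
           bij_betw butlast (SST l \<Lambda> \<mu>) (SST (l - 1) (butlast \<Lambda>) (butlast \<mu>)) \<and>
           bij_betw butlast (SST l \<Lambda> \<nu>) (SST (l - 1) (butlast \<Lambda>) (butlast \<nu>))) \<and>
        (\<forall>(A, P) \<in> ParMat l \<nu> \<mu>.
           (\<forall>p\<in>{1..l}. \<forall>q\<in>{1..l}. p = l \<or> q = l \<longrightarrow>
              (\<forall>i j. A (p, q) i j = 0 \<and> P (p, q) i j = [])) \<and>
           component (map shape (fst (Psi l (A, P)))) l = [] \<and>
           Psi (l - 1) (delete_last_blocks l (A, P)) =
             map_prod butlast butlast (Psi l (A, P))))
     \<and>
     (l = 1 \<longrightarrow>
        bij_betw (\<lambda>(A, P). A (1, 1))
          (ParMat 1 \<nu> \<mu>) (matrices_with_sums (component \<nu> 1) (component \<mu> 1)) \<and>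
        (\<forall>\<Lambda>. is_partition \<Lambda> \<and> sum_list \<Lambda> = n \<longrightarrow>
           bij_betw (\<lambda>T. [to_letters T])
             (SST_content \<Lambda> (component \<mu> 1)) (SST 1 [\<Lambda>] \<mu>) \<and>
           bij_betw (\<lambda>T. [to_letters T])
             (SST_content \<Lambda> (component \<nu> 1)) (SST 1 [\<Lambda>] \<nu>)) \<and>
        bij_betw (\<lambda>M. (shape (fst (rsk_matrix M)), rsk_matrix M))
          (matrices_with_sums (component \<nu> 1) (component \<mu> 1))
          (SIGMA \<Lambda>:{\<Lambda>. is_partition \<Lambda> \<and> sum_list \<Lambda> = n}.
             SST_content \<Lambda> (component \<mu> 1) \<times> SST_content \<Lambda> (component \<nu> 1)) \<and>
        (\<forall>(A, P) \<in> ParMat 1 \<nu> \<mu>.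
           (\<forall>i j. P (1, 1) i j = []) \<and>
           Psi 1 (A, P) =
             map_prod (\<lambda>T. [to_letters T]) (\<lambda>T. [to_letters T]) (rsk_matrix (A (1, 1)))))"
proof (intro conjI impI)
  show "bij_betw (\<lambda>X. (map shape (fst (Psi l X)), Psi l X))
       (ParMat l \<nu> \<mu>)
       (SIGMA \<Lambda>:multipartitions l n. SST l \<Lambda> \<mu> \<times> SST l \<Lambda> \<nu>)"
    by (rule bij_betw_Psi[OF assms(3,4)])
next
  assume *: "l \<ge> 2 \<and> sum_list (component \<mu> l) = 0 \<and> sum_list (component \<nu> l) = 0"
  then obtain m where l: "l = Suc m" by (cases l) auto
  have len: "length \<mu> = Suc m" "length \<nu> = Suc m"
    using assms(3,4) unfolding l multicompositions_def by blast+
  have zero: "sum_list (\<mu> ! m) = 0" "sum_list (\<nu> ! m) = 0" using * by (simp_all add: l)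
  show "bij_betw (delete_last_blocks l) (ParMat l \<nu> \<mu>) (ParMat (l - 1) (butlast \<nu>) (butlast \<mu>))"
    unfolding l diff_Suc_1 by (rule bij_betw_delete_last_blocks[OF len zero])
  show "bij_betw butlast {\<Lambda> \<in> multipartitions l n. component \<Lambda> l = []} (multipartitions (l - 1) n)"
    unfolding l diff_Suc_1 by (rule bij_betw_butlast_multipartitions)
  show "\<forall>\<Lambda> \<in> multipartitions l n. component \<Lambda> l = [] \<longrightarrow>
      (\<forall>T \<in> SST l \<Lambda> \<mu> \<union> SST l \<Lambda> \<nu>. component T l = []) \<and>
      bij_betw butlast (SST l \<Lambda> \<mu>) (SST (l - 1) (butlast \<Lambda>) (butlast \<mu>)) \<and>
      bij_betw butlast (SST l \<Lambda> \<nu>) (SST (l - 1) (butlast \<Lambda>) (butlast \<nu>))"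
    unfolding l diff_Suc_1
  proof (intro ballI impI conjI)
    fix \<Lambda> assume "\<Lambda> \<in> multipartitions (Suc m) n" and empty: "\<Lambda> ! m = []"
    then have \<Lambda>: "length \<Lambda> = Suc m" unfolding multipartitions_def multicompositions_def by blast
    show "bij_betw butlast (SST (Suc m) \<Lambda> \<mu>) (SST m (butlast \<Lambda>) (butlast \<mu>))"
      by (rule bij_betw_butlast_SST[OF len(1) zero(1) \<Lambda> empty])
    show "bij_betw butlast (SST (Suc m) \<Lambda> \<nu>) (SST m (butlast \<Lambda>) (butlast \<nu>))"
      by (rule bij_betw_butlast_SST[OF len(2) zero(2) \<Lambda> empty])
    fix T assume "T \<in> SST (Suc m) \<Lambda> \<mu> \<union> SST (Suc m) \<Lambda> \<nu>"
    then have "shape (T ! m) = \<Lambda> ! m" using SSTD(3)[of T "Suc m" _ _ "Suc m"] by auto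
    then show "T ! m = []" by (simp add: empty shape_def)
  qed
  show "\<forall>(A, P) \<in> ParMat l \<nu> \<mu>.
      (\<forall>p\<in>{1..l}. \<forall>q\<in>{1..l}. p = l \<or> q = l \<longrightarrow> (\<forall>i j. A (p, q) i j = 0 \<and> P (p, q) i j = [])) \<and>
      component (map shape (fst (Psi l (A, P)))) l = [] \<and>
      Psi (l - 1) (delete_last_blocks l (A, P)) = map_prod butlast butlast (Psi l (A, P))"
  proof (intro ballI case_prodI2)
    fix X A P assume "X \<in> ParMat l \<nu> \<mu>" "X = (A, P)"
    then have X: "(A, P) \<in> ParMat (Suc m) \<nu> \<mu>" by (simp add: l)
    show "(\<forall>p\<in>{1..l}. \<forall>q\<in>{1..l}. p = l \<or> q = l \<longrightarrow> (\<forall>i j. A (p, q) i j = 0 \<and> P (p, q) i j = [])) \<and>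
        component (map shape (fst (Psi l (A, P)))) l = [] \<and>
        Psi (l - 1) (delete_last_blocks l (A, P)) = map_prod butlast butlast (Psi l (A, P))"
      unfolding l diff_Suc_1
      by (intro conjI ballI impI allI ParMat_last_blocks[OF X zero] Psi_Suc[OF X zero] SigmaI)
  qed
next
  assume l: "l = 1"
  note comp = assms(3,4)[unfolded l]
  have len: "length \<mu> = 1" "length \<nu> = 1" using comp unfolding multicompositions_def by blast+
  show "bij_betw (\<lambda>(A, P). A (1, 1)) (ParMat 1 \<nu> \<mu>)
      (matrices_with_sums (component \<nu> 1) (component \<mu> 1))"
    by (rule bij_betw_single_matrix[OF len])
  show "\<forall>\<Lambda>. is_partition \<Lambda> \<and> sum_list \<Lambda> = n \<longrightarrow>
      bij_betw (\<lambda>T. [to_letters T]) (SST_content \<Lambda> (component \<mu> 1)) (SST 1 [\<Lambda>] \<mu>) \<and>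
      bij_betw (\<lambda>T. [to_letters T]) (SST_content \<Lambda> (component \<nu> 1)) (SST 1 [\<Lambda>] \<nu>)"
    using bij_betw_to_letters[OF len(1)] bij_betw_to_letters[OF len(2)] by blast
  show "bij_betw (\<lambda>M. (shape (fst (rsk_matrix M)), rsk_matrix M))
      (matrices_with_sums (component \<nu> 1) (component \<mu> 1))
      (SIGMA \<Lambda>:{\<Lambda>. is_partition \<Lambda> \<and> sum_list \<Lambda> = n}.
        SST_content \<Lambda> (component \<mu> 1) \<times> SST_content \<Lambda> (component \<nu> 1))"
    by (rule bij_betw_rsk_matrix[OF comp])
  show "\<forall>(A, P) \<in> ParMat 1 \<nu> \<mu>. (\<forall>i j. P (1, 1) i j = []) \<and>
      Psi 1 (A, P) =
        map_prod (\<lambda>T. [to_letters T]) (\<lambda>T. [to_letters T]) (rsk_matrix (A (1, 1)))"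
    by (intro ballI case_prodI2 conjI allI) (use ParMat_1_Nil Psi_1 in blast)+
qed

end
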